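(* Let $F$ be a perfect idyll, $S$ and $T$ finite sets, $M$ an $F$-matroid on $T$ and $\Phi$ a submonomial matrix with coefficients in $F$ indexed by $T\times S$. Then there is a unique $F$-matroid $N$ on $S$ with vector set \[ \mathcal V_N=\Phi^{-1}(\mathcal V_M)=\{V\in F^S\mid \Phi\cdot V\in\mathcal V_M\}. \]
   Context: An idyll is a commutative multiplicative monoid $F$ with an element $0$ satisfying $0\cdot a=0$ for all $a$ and such that $F^\times=F\setminus\{0\}$ is an abelian group, together with a subset $N_F$ (the nullset) of the group semiring $\mathbb N[F^\times]$ (where $0\in F$ is identified with the empty sum) such that $0\in N_F$, $1\notin N_F$, $N_F+N_F\subseteq N_F$, $\mathbb N[F^\times]\cdot N_F\subseteq N_F$, and there is a unique element $-1\in F^\times$ with $1+(-1)\in N_F$. Let $E$ be a finite set and $r\ge 0$. A Grassmann-Plücker function of rank $r$ on $E$ with coefficients in $F$ is a nonzero function $\varphi:E^r\to F$ that is alternating (i.e. $\varphi(x_{\sigma(1)},\dots,x_{\sigma(r)})=\mathrm{sign}(\sigma)\varphi(x_1,\dots,x_r)$ for all permutations $\sigma$, and $\varphi(x_1,\dots,x_r)=0$ if the $x_i$ are not pairwise distinct) and satisfies $\sum_{k=0}^r(-1)^k\varphi(y_0,\dots,\widehat{y_k},\dots,y_r)\varphi(y_k,x_2,\dots,x_r)\in N_F$ for all $x_2,\dots,x_r,y_0,\dots,y_r\in E$. An $F$-matroid of rank $r$ on $E$ is a class $M=[\varphi]$ of such functions up to multiplication by elements of $F^\times$. Dual: fix a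 total order on $E$ and let $n=\#E$; $M^*=[\varphi^*]$ with $\varphi^*:E^{n-r}\to F$, $\varphi^*(x)=0$ if $x$ has repeated entries, and $\varphi^*(x)=\mathrm{sign}(x,x')\varphi(x')$ otherwise, where $x'\in E^r$ lists the complement of the entries of $x$ and $\mathrm{sign}(x,x')\in\{\pm1\}$ is the sign of the permutation sorting $(x,x')$. Circuits: $\mathcal C_M\subseteq F^E$ consists of all $aX_y$ with $a\in F^\times$ and $y=(y_0,\dots,y_r)\in E^{r+1}$ with distinct entries and $\varphi(y_0,\dots,\widehat{y_k},\dots,y_r)\ne0$ for some $k$, where $X_y(y_i)=(-1)^i\varphi(y_0,\dots,\widehat{y_i},\dots,y_r)$ and $X_y(x)=0$ for other $x$. Cocircuits: $\mathcal C_M^*=\mathcal C_{M^*}$. For $X,Y\in F^E$ write $X\perp Y$ if $\sum_{e}X_eY_e\in N_F$. Vectors: $\mathcal V_M=\{X\in F^E: X\perp Y\ \forall Y\in\mathcal C_M^*\}$. Covectors: $\mathcal V_M^*=\{X\in F^E:X\perp Y\ \forall Y\in\mathcal C_M\}$. The idyll $F$ is perfect if $X\perp Y$ for all $F$-matroids $M$, $X\in\mathcal V_M$, $Y\in\mathcal V_M^*$. A submonomial $F$-matrix indexed by $T\times S$ is a matrix $\Phi=(\Phi_{i,j})_{(i,j)\in T\times S}$ with entries in $F$ such that each row and each column has at most one nonzero entry; it defines a map $F^S\to F^T$, $(\Phi\cdot X)_i=\sum_{j}\Phi_{i,j}X_j$ (at most one nonzero term). *)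

theory Defs
  imports "HOL-Library.Multiset" "HOL-Combinatorics.Permutations"
begin

section \<open>Idylls\<close>

text \<open>
  The group semiring of \<open>F\<^sup>\<times>\<close> with coefficients in \<open>\<nat>\<close> is represented by the finite multisets over
  \<open>F\<close> that do not contain \<open>0\<close>: addition is multiset union, \<open>{#}\<close> is zero, and \<open>a \<noteq> 0\<close> is
  identified with \<open>{#a#}\<close>.
\<close>

definition group_semiring :: "'f::{comm_monoid_mult, mult_zero} multiset set" where
  "group_semiring = {A. 0 \<notin># A}"

definition gs_times ::
    "'f::{comm_monoid_mult, mult_zero} multiset \<Rightarrow> 'f multiset \<Rightarrow> 'f multiset" where
  "gs_times A B = (\<Sum>a\<in>#A. image_mset (\<lambda>b. a * b) B)"

definition gs_embed :: "'f::{comm_monoid_mult, mult_zero} \<Rightarrow> 'f multiset" where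
  "gs_embed a = (if a = 0 then {#} else {#a#})"

text \<open>
  The multiplicative structure of the idyll is that of the type \<open>'f\<close>. The first two assumptions
  say that the nonzero elements form an abelian group; closure under multiplication follows.
\<close>

locale idyll =
  fixes NF :: "'f::{comm_monoid_mult, mult_zero} multiset set"
  assumes one_neq_zero: "(1::'f) \<noteq> 0"
    and invertible: "\<And>a::'f. a \<noteq> 0 \<Longrightarrow> \<exists>b. a * b = 1"
    and null_subset: "NF \<subseteq> group_semiring"
    and null_zero: "{#} \<in> NF"
    and null_one: "gs_embed 1 \<notin> NF"
    and null_add: "\<And>A B. A \<in> NF \<Longrightarrow> B \<in> NF \<Longrightarrow> A + B \<in> NF"
    and null_times: "\<And>A B. A \<in> group_semiring \<Longrightarrow> B \<in> NF \<Longrightarrow> gs_times A B \<in> NF"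
    and ex1_neg_one: "\<exists>!m. m \<noteq> 0 \<and> gs_embed 1 + gs_embed m \<in> NF"

definition neg_one :: "'f::{comm_monoid_mult, mult_zero} multiset set \<Rightarrow> 'f" where
  "neg_one NF = (THE m. m \<noteq> 0 \<and> gs_embed 1 + gs_embed m \<in> NF)"

definition sign_in :: "'f::{comm_monoid_mult, mult_zero} multiset set \<Rightarrow> (nat \<Rightarrow> nat) \<Rightarrow> 'f" where
  "sign_in NF p = (if sign p = 1 then 1 else neg_one NF)"


section \<open>Matroids with coefficients in an idyll\<close>

definition tuples :: "'e set \<Rightarrow> nat \<Rightarrow> 'e list set" where
  "tuples E r = {xs. set xs \<subseteq> E \<and> length xs = r}"

definition omit :: "nat \<Rightarrow> 'e list \<Rightarrow> 'e list" where
  "omit k ys = take k ys @ drop (Suc k) ys"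

text \<open>
  A function on \<open>E\<^sup>r\<close> is extended by \<open>0\<close> to all lists, so that equality of such functions is
  equality in HOL; likewise an element of \<open>F\<^sup>E\<close> is extended by \<open>0\<close> outside \<open>E\<close>. Positions in tuples
  are counted from \<open>0\<close>.

  In the last condition, \<open>xs\<close> stands for \<open>(x\<^sub>2, \<dots>, x\<^sub>r)\<close>. For \<open>r = 0\<close> there is no such \<open>xs\<close> and the
  condition is void.
\<close>

definition gp_function ::
    "'f::{comm_monoid_mult, mult_zero} multiset set \<Rightarrow> 'e set \<Rightarrow> nat \<Rightarrow> ('e list \<Rightarrow> 'f) \<Rightarrow> bool" where
  "gp_function NF E r \<phi> \<longleftrightarrow>
     (\<forall>xs. xs \<notin> tuples E r \<longrightarrow> \<phi> xs = 0) \<and>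
     (\<exists>xs. \<phi> xs \<noteq> 0) \<and>
     (\<forall>xs \<in> tuples E r. \<forall>p. p permutes {..<r} \<longrightarrow> \<phi> (permute_list p xs) = sign_in NF p * \<phi> xs) \<and>
     (\<forall>xs \<in> tuples E r. \<not> distinct xs \<longrightarrow> \<phi> xs = 0) \<and>
     (\<forall>xs ys. set xs \<subseteq> E \<and> Suc (length xs) = r \<and> ys \<in> tuples E (Suc r) \<longrightarrow>
        (\<Sum>k = 0..r. gs_embed (neg_one NF ^ k * \<phi> (omit k ys) * \<phi> ((ys ! k) # xs))) \<in> NF)"

definition gp_class :: "('e list \<Rightarrow> 'f::{comm_monoid_mult, mult_zero}) \<Rightarrow> ('e list \<Rightarrow> 'f) set" where
  "gp_class \<phi> = {(\<lambda>xs. a * \<phi> xs) | a. a \<noteq> 0}"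

record ('e, 'f) fmatroid =
  ground :: "'e set"
  rank :: nat
  gp_fns :: "('e list \<Rightarrow> 'f) set"

definition is_fmatroid ::
    "'f::{comm_monoid_mult, mult_zero} multiset set \<Rightarrow> ('e, 'f) fmatroid \<Rightarrow> bool" where
  "is_fmatroid NF M \<longleftrightarrow> finite (ground M) \<and>
     (\<exists>\<phi>. gp_function NF (ground M) (rank M) \<phi> \<and> gp_fns M = gp_class \<phi>)"


subsection \<open>Duality\<close>

text \<open>
  A total order on the finite set \<open>E\<close> is fixed in the form of an enumeration of \<open>E\<close>. The dual
  matroid does not depend on the choice, since \<open>\<phi>\<^sup>*\<close> changes at most by a sign.
\<close>

definition enum_of :: "'e set \<Rightarrow> 'e list" where
  "enum_of E = (SOME es. distinct es \<and> set es = E)"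

definition sorting_perm :: "'e list \<Rightarrow> 'e list \<Rightarrow> nat \<Rightarrow> nat" where
  "sorting_perm es zs = (THE p. p permutes {..<length zs} \<and> permute_list p zs = es)"

definition compl_tuple :: "'e set \<Rightarrow> 'e list \<Rightarrow> 'e list" where
  "compl_tuple E xs = filter (\<lambda>e. e \<notin> set xs) (enum_of E)"

definition dual_gp ::
    "'f::{comm_monoid_mult, mult_zero} multiset set \<Rightarrow> 'e set \<Rightarrow> nat \<Rightarrow> ('e list \<Rightarrow> 'f) \<Rightarrow> 'e list \<Rightarrow> 'f"
  where
  "dual_gp NF E r \<phi> xs =
     (if xs \<in> tuples E (card E - r) \<and> distinct xs
      then sign_in NF (sorting_perm (enum_of E) (xs @ compl_tuple E xs)) * \<phi> (compl_tuple E xs)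
      else 0)"

definition dual_fmatroid ::
    "'f::{comm_monoid_mult, mult_zero} multiset set \<Rightarrow> ('e, 'f) fmatroid \<Rightarrow> ('e, 'f) fmatroid" where
  "dual_fmatroid NF M =
     \<lparr>ground = ground M, rank = card (ground M) - rank M,
      gp_fns = dual_gp NF (ground M) (rank M) ` gp_fns M\<rparr>"


subsection \<open>Circuits and vectors\<close>

definition fspace :: "'e set \<Rightarrow> ('e \<Rightarrow> 'f::{comm_monoid_mult, mult_zero}) set" where
  "fspace E = {X. \<forall>e. e \<notin> E \<longrightarrow> X e = 0}"

definition circuit_vec ::
    "'f::{comm_monoid_mult, mult_zero} multiset set \<Rightarrow> ('e list \<Rightarrow> 'f) \<Rightarrow> 'e list \<Rightarrow> 'e \<Rightarrow> 'f" where
  "circuit_vec NF \<phi> ys e =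
     (if e \<in> set ys
      then let i = (THE i. i < length ys \<and> ys ! i = e) in neg_one NF ^ i * \<phi> (omit i ys)
      else 0)"

definition circuits ::
    "'f::{comm_monoid_mult, mult_zero} multiset set \<Rightarrow> ('e, 'f) fmatroid \<Rightarrow> ('e \<Rightarrow> 'f) set" where
  "circuits NF M =
     {(\<lambda>e. a * circuit_vec NF \<phi> ys e) | a \<phi> ys.
        a \<noteq> 0 \<and> \<phi> \<in> gp_fns M \<and> ys \<in> tuples (ground M) (Suc (rank M)) \<and> distinct ys \<and>
        (\<exists>k \<le> rank M. \<phi> (omit k ys) \<noteq> 0)}"

definition cocircuits ::
    "'f::{comm_monoid_mult, mult_zero} multiset set \<Rightarrow> ('e, 'f) fmatroid \<Rightarrow> ('e \<Rightarrow> 'f) set" where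
  "cocircuits NF M = circuits NF (dual_fmatroid NF M)"

definition orthogonal ::
    "'f::{comm_monoid_mult, mult_zero} multiset set \<Rightarrow> 'e set \<Rightarrow> ('e \<Rightarrow> 'f) \<Rightarrow> ('e \<Rightarrow> 'f) \<Rightarrow> bool" where
  "orthogonal NF E X Y \<longleftrightarrow> (\<Sum>e\<in>E. gs_embed (X e * Y e)) \<in> NF"

definition vectors ::
    "'f::{comm_monoid_mult, mult_zero} multiset set \<Rightarrow> ('e, 'f) fmatroid \<Rightarrow> ('e \<Rightarrow> 'f) set" where
  "vectors NF M =
     {X \<in> fspace (ground M). \<forall>Y \<in> cocircuits NF M. orthogonal NF (ground M) X Y}"

definition covectors ::
    "'f::{comm_monoid_mult, mult_zero} multiset set \<Rightarrow> ('e, 'f) fmatroid \<Rightarrow> ('e \<Rightarrow> 'f) set" where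
  "covectors NF M =
     {X \<in> fspace (ground M). \<forall>Y \<in> circuits NF M. orthogonal NF (ground M) X Y}"

text \<open>
  A definition cannot quantify over all types of ground sets; every finite set is in bijection with
  a finite set of natural numbers, so it is enough to range over matroids on the latter.
\<close>

definition perfect_idyll :: "'f::{comm_monoid_mult, mult_zero} multiset set \<Rightarrow> bool" where
  "perfect_idyll NF \<longleftrightarrow> idyll NF \<and>
     (\<forall>M :: (nat, 'f) fmatroid. is_fmatroid NF M \<longrightarrow>
        (\<forall>X \<in> vectors NF M. \<forall>Y \<in> covectors NF M. orthogonal NF (ground M) X Y))"


section \<open>Submonomial matrices\<close>

text \<open>Only the entries of \<open>\<Phi>\<close> indexed by \<open>T \<times> S\<close> are relevant.\<close>

definition submonomial ::
    "'t set \<Rightarrow> 's set \<Rightarrow> ('t \<Rightarrow> 's \<Rightarrow> 'f::{comm_monoid_mult, mult_zero}) \<Rightarrow> bool" where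
  "submonomial T S \<Phi> \<longleftrightarrow>
     (\<forall>i\<in>T. \<forall>j\<in>S. \<forall>j'\<in>S. \<Phi> i j \<noteq> 0 \<and> \<Phi> i j' \<noteq> 0 \<longrightarrow> j = j') \<and>
     (\<forall>j\<in>S. \<forall>i\<in>T. \<forall>i'\<in>T. \<Phi> i j \<noteq> 0 \<and> \<Phi> i' j \<noteq> 0 \<longrightarrow> i = i')"

text \<open>
  The sum of the \<open>\<Phi>\<^sub>i\<^sub>j X\<^sub>j\<close> is formed in the group semiring; having at most one nonzero term, it is
  (the image of) an element of \<open>F\<close>.
\<close>

definition mat_apply ::
    "'t set \<Rightarrow> 's set \<Rightarrow> ('t \<Rightarrow> 's \<Rightarrow> 'f::{comm_monoid_mult, mult_zero}) \<Rightarrow> ('s \<Rightarrow> 'f) \<Rightarrow> 't \<Rightarrow> 'f" where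
  "mat_apply T S \<Phi> X i =
     (if i \<in> T then (THE a. gs_embed a = (\<Sum>j\<in>S. gs_embed (\<Phi> i j * X j))) else 0)"

end

theory Submission
  imports Defs
begin

text \<open>
  A submonomial matrix \<open>\<Phi>\<close> sends the coordinate \<open>s\<close>, multiplied by a scalar \<open>c s\<close>, to one coordinate
  \<open>f s\<close> of \<open>T\<close>, with \<open>c s = 0\<close> for a zero column and \<open>f\<close> injective on the support of \<open>c\<close>. Hence
  \<open>\<Phi> V\<close> is supported on the image \<open>I\<close> of that support, and the matroid \<open>N\<close> has to be the restriction
  of \<open>M\<close> to \<open>I\<close>, rescaled by \<open>c\<close>, together with a loop for every zero column.

  If \<open>\<phi>\<close> is a Grassmann-Pluecker function of \<open>M\<close>, choose a basis \<open>(t\<^sub>1, \<dots>, t\<^sub>k, a)\<close> of \<open>M\<close> with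
  \<open>t\<^sub>1, \<dots>, t\<^sub>k \<in> I\<close> and \<open>k\<close> as large as possible. Then
  \<open>\<psi> (x\<^sub>1, \<dots>, x\<^sub>k) = c x\<^sub>1 \<cdots> c x\<^sub>k \<phi> (f x\<^sub>1, \<dots>, f x\<^sub>k, a)\<close> is a Grassmann-Pluecker function on \<open>S\<close>
  (\<open>pullback_gp_function\<close>): the relation of \<open>\<phi>\<close> for the tuples extended by \<open>a\<close> only gains terms in which
  an entry of \<open>a\<close> is repeated.

  To compare vectors, duality is eliminated first (\<open>vectors_iff\<close>): up to scalars, the cocircuits of \<open>M\<close>
  are the functions \<open>e \<mapsto> \<phi> (e, z)\<close> for tuples \<open>z\<close> of length \<open>r - 1\<close>. The cocircuits of \<open>N\<close> then
  come from tuples \<open>(f z, a)\<close>, so they are pulled back from cocircuits of \<open>M\<close>, and \<open>\<Phi> V \<in> \<V>\<^sub>M\<close>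
  implies \<open>V \<in> \<V>\<^sub>N\<close>. Conversely, maximality of \<open>k\<close> makes the pullback of any cocircuit of \<open>M\<close> a
  covector of \<open>N\<close>. It need not be a multiple of a cocircuit of \<open>N\<close>, which is where perfection of the
  idyll enters: it makes each vector of \<open>N\<close> orthogonal to these covectors (\<open>perfect_orthogonal\<close>).

  For uniqueness (\<open>matroid_determined_by_vectors\<close>), call a set independent if no
  nonzero vector is supported on it; this depends on the vectors alone. Each basis is independent, and
  the vector supported on a basis and one further element \<open>e\<close>, a fundamental circuit, allows to exchange
  an element of the basis for \<open>e\<close>. By such exchanges any basis can be moved until it contains a given
  independent set (\<open>exchange_towards\<close>). So the bases are determined by the vectors, and any two bases
  are connected by exchanges. Orthogonality of a circuit of one matroid to a cocircuit of the other one
  shows that two Grassmann-Pluecker functions with the same vectors change by the same factor along an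
  exchange; hence they are proportional.
\<close>

section \<open>Arithmetic in an idyll\<close>

context idyll
begin

lemma mult_eq_zero_iff: "a * b = (0::'f) \<longleftrightarrow> a = 0 \<or> b = 0"
proof
  assume ab: "a * b = 0"
  show "a = 0 \<or> b = 0"
  proof (rule disjCI)
    assume "b \<noteq> 0"
    then obtain c where "b * c = 1" using invertible by blast
    then have "a = a * b * c" by (simp add: mult.assoc)
    then show "a = 0" using ab by simp
  qed
qed auto

lemma mult_left_cancel_nonzero: "a \<noteq> (0::'f) \<Longrightarrow> a * b = a * c \<Longrightarrow> b = c"
proof -
  assume "a \<noteq> 0" and eq: "a * b = a * c"
  then obtain d where d: "a * d = 1" using invertible by blast
  have "b = a * d * b" "c = a * d * c" using d by simp_all
  then show "b = c" using eq by (metis mult.assoc mult.commute)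
qed

lemma prod_list_eq_zero_iff: "prod_list xs = (0::'f) \<longleftrightarrow> 0 \<in> set xs"
  by (induction xs) (auto simp: one_neq_zero mult_eq_zero_iff)

lemma gs_embed_zero [simp]: "gs_embed (0::'f) = {#}"
  by (simp add: gs_embed_def)

lemma gs_embed_inj: "gs_embed a = gs_embed b \<longleftrightarrow> a = (b::'f)"
  by (auto simp: gs_embed_def)

lemma gs_embed_scale: "K \<noteq> (0::'f) \<Longrightarrow> gs_embed (K * a) = image_mset ((*) K) (gs_embed a)"
  by (auto simp: gs_embed_def mult_eq_zero_iff)

lemma null_scale:
  fixes t :: "'i \<Rightarrow> 'f"
  assumes "(\<Sum>i\<in>I. gs_embed (t i)) \<in> NF"
  shows "(\<Sum>i\<in>I. gs_embed (K * t i)) \<in> NF"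
proof (cases "K = 0")
  case True
  then show ?thesis by (simp add: null_zero)
next
  case False
  have "(\<Sum>i\<in>I. gs_embed (K * t i)) = image_mset ((*) K) (\<Sum>i\<in>I. gs_embed (t i))"
    by (induction I rule: infinite_finite_induct) (auto simp: gs_embed_scale[OF False])
  also have "\<dots> = gs_times {#K#} (\<Sum>i\<in>I. gs_embed (t i))"
    by (simp add: gs_times_def)
  also have "\<dots> \<in> NF"
    using null_times[OF _ assms, of "{#K#}"] False by (simp add: group_semiring_def)
  finally show ?thesis .
qed

lemma null_scale_pair:
  "gs_embed a + gs_embed b \<in> NF \<Longrightarrow> gs_embed (K * a) + gs_embed (K * b) \<in> NF"
  using null_scale[where I = "UNIV :: bool set" and t = "\<lambda>i. if i then a else b" and K = K]
  by (simp add: UNIV_bool add.commute)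

lemma null_single_iff: "gs_embed a \<in> NF \<longleftrightarrow> a = 0"
proof
  assume a: "gs_embed a \<in> NF"
  show "a = 0"
  proof (rule ccontr)
    assume "a \<noteq> 0"
    then obtain b where b: "a * b = 1" using invertible by blast
    have "gs_embed (b * a) \<in> NF"
      using null_scale[where I = "{()}" and t = "\<lambda>_. a" and K = b] a by simp
    then show False using b null_one by (simp add: mult.commute)
  qed
qed (simp add: null_zero)

lemma neg_one_nonzero: "neg_one NF \<noteq> 0"
  and null_one_neg_one: "gs_embed 1 + gs_embed (neg_one NF) \<in> NF"
  using theI'[OF ex1_neg_one] by (auto simp: neg_one_def)

lemma neg_one_unique: "gs_embed 1 + gs_embed m \<in> NF \<Longrightarrow> m = neg_one NF"
  using ex1_neg_one neg_one_nonzero null_one_neg_one null_one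
  by (cases "m = 0") auto

lemma neg_one_square: "neg_one NF * neg_one NF = 1"
proof -
  obtain b where b: "neg_one NF * b = 1" using invertible neg_one_nonzero by blast
  have "gs_embed 1 + gs_embed b \<in> NF"
    using null_scale_pair[OF null_one_neg_one, of b] b by (simp add: mult.commute add.commute)
  then show ?thesis using neg_one_unique b by blast
qed

lemma neg_one_power_square: "neg_one NF ^ m * neg_one NF ^ m = 1"
  by (simp add: power_mult_distrib[symmetric] neg_one_square)

lemma neg_one_power_cancel: "neg_one NF ^ m * (neg_one NF ^ m * a) = a"
  using neg_one_power_square[of m] by (simp add: mult.assoc[symmetric])

lemma neg_one_power_mult_cancel: "(neg_one NF ^ m * a) * (neg_one NF ^ m * b) = a * b"
proof -
  have "(neg_one NF ^ m * a) * (neg_one NF ^ m * b) = (neg_one NF ^ m * neg_one NF ^ m) * (a * b)"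
    by (simp only: ac_simps)
  then show ?thesis by (simp add: neg_one_power_square)
qed

lemma neg_one_power_nonzero: "neg_one NF ^ m \<noteq> 0"
  using neg_one_power_square[of m] one_neq_zero by auto

text \<open>
  Uniqueness of \<open>-1\<close> propagates, after division, to uniqueness of additive inverses. This is how
  equalities in \<open>F\<close> are extracted from membership in the nullset.
\<close>

lemma null_difference:
  assumes "gs_embed a + gs_embed (neg_one NF * b) \<in> NF"
  shows "a = b"
proof (cases "a = 0")
  case True
  then show ?thesis using assms by (auto simp: null_single_iff mult_eq_zero_iff neg_one_nonzero)
next
  case False
  then obtain c where c: "a * c = 1" using invertible by blast
  have "gs_embed 1 + gs_embed (c * (neg_one NF * b)) \<in> NF"
    using null_scale_pair[OF assms, of c] c by (simp add: mult.commute)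
  then have "neg_one NF * (c * b) = neg_one NF * (c * a)"
    using neg_one_unique[of "c * (neg_one NF * b)"] c
    by (simp add: mult.left_commute mult.commute[of c a])
  then have "c * b = c * a"
    by (rule mult_left_cancel_nonzero[OF neg_one_nonzero])
  moreover have "c \<noteq> 0" using c one_neq_zero by auto
  ultimately show ?thesis using mult_left_cancel_nonzero[of c b a] by simp
qed

end

section \<open>Alternating functions and adjacent transpositions\<close>

text \<open>
  The sign rule for adjacent transpositions only, without reference to a length or a ground set. Both
  Grassmann-Pluecker functions and the sign of an arrangement satisfy it.
\<close>

definition adj_alternating ::
    "'f::{comm_monoid_mult, mult_zero} multiset set \<Rightarrow> ('e list \<Rightarrow> 'f) \<Rightarrow> bool" where
  "adj_alternating NF \<psi> \<longleftrightarrow> (\<forall>u a b v. \<psi> (u @ a # b # v) = neg_one NF * \<psi> (u @ b # a # v))"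

lemma permute_list_adjacent:
  "permute_list (transpose (length u) (Suc (length u))) (u @ b # a # v) = u @ a # b # v"
proof (rule nth_equalityI)
  fix i
  assume i: "i < length (permute_list (transpose (length u) (Suc (length u))) (u @ b # a # v))"
  consider "i < length u" | "i = length u" | "i = Suc (length u)"
    | j where "i = Suc (Suc (length u + j))"
    by (metis less_natE linorder_neqE_nat Suc_lessI)
  then show "permute_list (transpose (length u) (Suc (length u))) (u @ b # a # v) ! i =
      (u @ a # b # v) ! i"
    using i by cases (simp_all add: permute_list_def nth_append transpose_apply_other del: upt_Suc)
qed simp

lemma transpose_permutes_lessThan:
  "transpose (length u) (Suc (length u)) permutes {..<length (u @ a # b # v)}"
  by (rule permutes_swap_id) auto

lemma adj_alternating_move:
  assumes "adj_alternating NF \<psi>"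
  shows "\<psi> (u @ a # p @ v) = neg_one NF ^ length p * \<psi> (u @ p @ a # v)"
proof (induction p arbitrary: u)
  case (Cons b p)
  have "\<psi> (u @ a # b # p @ v) = neg_one NF * \<psi> (u @ b # a # p @ v)"
    using assms unfolding adj_alternating_def by blast
  then show ?case using Cons[of "u @ [b]"] by (simp add: mult.assoc)
qed simp

text \<open>
  The sign of a rearrangement does not depend on the alternating function. This uniformity lets signs of
  different alternating functions cancel against each other.
\<close>

lemma adj_alternating_rearrange:
  fixes NF :: "'f::{comm_monoid_mult, mult_zero} multiset set" and xs ys :: "'e list"
  assumes "mset xs = mset ys"
  shows "\<exists>m. \<forall>\<psi> u v. adj_alternating NF \<psi> \<longrightarrow>
    \<psi> (u @ xs @ v) = neg_one NF ^ m * \<psi> (u @ ys @ v)"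
  using assms
proof (induction xs arbitrary: ys)
  case Nil
  then show ?case by (intro exI[of _ 0]) auto
next
  case (Cons a xs)
  then have "a \<in> set ys" using mset_eq_setD[OF Cons.prems] by auto
  then obtain p q where ys: "ys = p @ a # q" by (auto simp: in_set_conv_decomp)
  with Cons.prems have "mset xs = mset (p @ q)" by simp
  from Cons.IH[OF this] obtain m where m: "\<forall>\<psi> u v. adj_alternating NF \<psi> \<longrightarrow>
      \<psi> (u @ xs @ v) = neg_one NF ^ m * \<psi> (u @ (p @ q) @ v)" ..
  have "\<psi> (u @ (a # xs) @ v) = neg_one NF ^ (m + length p) * \<psi> (u @ ys @ v)"
    if alt: "adj_alternating NF \<psi>" for \<psi> u v
  proof -
    have "\<psi> (u @ (a # xs) @ v) = neg_one NF ^ m * \<psi> (u @ a # p @ q @ v)"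
      using m[rule_format, OF alt, of "u @ [a]" v] by simp
    also have "\<psi> (u @ a # p @ q @ v) = neg_one NF ^ length p * \<psi> (u @ p @ a # q @ v)"
      by (rule adj_alternating_move[OF alt])
    finally show ?thesis by (simp add: ys power_add mult.assoc)
  qed
  then show ?case by (intro exI[of _ "m + length p"] allI impI)
qed

lemma gp_adj_alternating:
  fixes \<phi> :: "'e list \<Rightarrow> 'f::{comm_monoid_mult, mult_zero}"
  assumes "gp_function NF E r \<phi>"
  shows "adj_alternating NF \<phi>"
  unfolding adj_alternating_def
proof (intro allI)
  fix u :: "'e list" and a b v
  let ?w = "u @ b # a # v" and ?p = "transpose (length u) (Suc (length u))"
  show "\<phi> (u @ a # b # v) = neg_one NF * \<phi> ?w"
  proof (cases "?w \<in> tuples E r")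
    case True
    then have "?p permutes {..<r}"
      using transpose_permutes_lessThan[of u b a v] by (simp add: tuples_def)
    then have "\<phi> (permute_list ?p ?w) = sign_in NF ?p * \<phi> ?w"
      using assms True by (simp add: gp_function_def)
    then show ?thesis by (simp add: permute_list_adjacent sign_in_def sign_swap_id)
  next
    case False
    then have "u @ a # b # v \<notin> tuples E r" by (auto simp: tuples_def)
    then show ?thesis using assms False by (simp add: gp_function_def)
  qed
qed

lemma gp_rearrange:
  assumes "gp_function NF E r \<phi>" and "mset xs = mset ys"
  shows "\<exists>m. \<forall>u v. \<phi> (u @ xs @ v) = neg_one NF ^ m * \<phi> (u @ ys @ v)"
proof -
  obtain m where "\<forall>\<psi> u v. adj_alternating NF \<psi> \<longrightarrow>
      \<psi> (u @ xs @ v) = neg_one NF ^ m * \<psi> (u @ ys @ v)"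
    using adj_alternating_rearrange[OF assms(2)] ..
  from this[rule_format, OF gp_adj_alternating[OF assms(1)]] show ?thesis by blast
qed

lemma gp_nonzeroD:
  assumes "gp_function NF E r \<phi>" and "\<phi> xs \<noteq> 0"
  shows "set xs \<subseteq> E" "length xs = r" "distinct xs"
proof -
  have "xs \<in> tuples E r" using assms unfolding gp_function_def by blast
  moreover from this show "distinct xs" using assms unfolding gp_function_def by blast
  ultimately show "set xs \<subseteq> E" "length xs = r" by (simp_all add: tuples_def)
qed


section \<open>The sign of an arrangement of the ground set\<close>

text \<open>
  The sign in the definition of the dual function, extended by \<open>0\<close> to all lists. In this form it is
  alternating, so all signs of the duality can be computed by moving entries.
\<close>

definition arrangement_sign ::
    "'f::{comm_monoid_mult, mult_zero} multiset set \<Rightarrow> 'e set \<Rightarrow> 'e list \<Rightarrow> 'f" where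
  "arrangement_sign NF E w =
     (if distinct w \<and> set w = E then sign_in NF (sorting_perm (enum_of E) w) else 0)"

lemma enum_of:
  assumes "finite E"
  shows "distinct (enum_of E)" "set (enum_of E) = E"
  using someI_ex[of "\<lambda>es. distinct es \<and> set es = E"] finite_distinct_list[OF assms]
  by (auto simp: enum_of_def)

lemma permute_list_distinct_inj:
  assumes "distinct zs" "p permutes {..<length zs}" "q permutes {..<length zs}"
    and "permute_list p zs = permute_list q zs"
  shows "p = q"
proof
  fix i
  show "p i = q i"
  proof (cases "i < length zs")
    case True
    then have "p i < length zs" "q i < length zs"
      using assms(2,3) permutes_in_image by fastforce+
    moreover have "zs ! p i = zs ! q i"
      using arg_cong[OF assms(4), of "\<lambda>l. l ! i"] True assms(2,3) by (simp add: permute_list_nth)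
    ultimately show ?thesis using assms(1) by (simp add: nth_eq_iff_index_eq)
  next
    case False
    then show ?thesis using assms(2,3) by (simp add: permutes_not_in)
  qed
qed

lemma sorting_perm_eqI:
  assumes "distinct zs" "p permutes {..<length zs}" "permute_list p zs = es"
  shows "sorting_perm es zs = p"
  unfolding sorting_perm_def
  using assms by (intro the_equality) (auto intro: permute_list_distinct_inj[OF assms(1)])

lemma sorting_permE:
  assumes "distinct zs" "distinct es" "set zs = set es"
  obtains p where "p permutes {..<length zs}" "permute_list p zs = es" "sorting_perm es zs = p"
proof -
  have "mset es = mset zs" using assms by (simp add: set_eq_iff_mset_eq_distinct)
  then obtain p where "p permutes {..<length zs}" "permute_list p zs = es"
    by (rule mset_eq_permutation)
  then show thesis using that sorting_perm_eqI[OF assms(1)] by blast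
qed

context idyll
begin

lemma arrangement_sign_adj_alternating:
  fixes E :: "'e set"
  assumes "finite E"
  shows "adj_alternating NF (arrangement_sign NF E)"
  unfolding adj_alternating_def
proof (intro allI)
  fix u :: "'e list" and a b v
  let ?w = "u @ b # a # v" and ?w' = "u @ a # b # v"
  let ?t = "transpose (length u) (Suc (length u))"
  show "arrangement_sign NF E ?w' = neg_one NF * arrangement_sign NF E ?w"
  proof (cases "distinct ?w \<and> set ?w = E")
    case True
    then have d: "distinct ?w" "distinct ?w'" and s: "set ?w = set (enum_of E)" "set ?w' = E"
      using enum_of[OF assms] by auto
    obtain p where p: "p permutes {..<length ?w}" "permute_list p ?w = enum_of E"
        "sorting_perm (enum_of E) ?w = p"
      using sorting_permE[OF d(1) enum_of(1)[OF assms] s(1)] by blast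
    have t: "?t permutes {..<length ?w'}" by (rule transpose_permutes_lessThan)
    have p': "p permutes {..<length ?w'}" using p(1) by simp
    \<comment> \<open>If \<open>p\<close> sorts \<open>?w\<close>, then undoing the transposition and applying \<open>p\<close> sorts \<open>?w'\<close>.\<close>
    have "permute_list (?t \<circ> p) ?w' = enum_of E"
      using permute_list_compose[OF p', of ?t] p(2) by (simp add: permute_list_adjacent)
    then have sp: "sorting_perm (enum_of E) ?w' = ?t \<circ> p"
      using d(2) permutes_compose[OF p' t] by (intro sorting_perm_eqI)
    have "sign (?t \<circ> p) = - sign p"
      using sign_compose[OF permutation_swap_id permutes_imp_permutation[OF finite_lessThan p(1)]]
      by (simp add: sign_swap_id)
    then have "sign_in NF (?t \<circ> p) = neg_one NF * sign_in NF p"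
      using sign_cases[of p] by (auto simp: sign_in_def neg_one_square)
    then show ?thesis using d s True p(3) sp by (simp add: arrangement_sign_def)
  next
    case False
    then have "\<not> (distinct ?w' \<and> set ?w' = E)" by auto
    with False show ?thesis by (simp only: arrangement_sign_def if_False mult_zero_right)
  qed
qed

lemma arrangement_sign_nonzero:
  "distinct w \<Longrightarrow> set w = E \<Longrightarrow> arrangement_sign NF E w \<noteq> 0"
  by (auto simp: arrangement_sign_def sign_in_def one_neq_zero neg_one_nonzero)

end

section \<open>Tuples and circuits\<close>

lemma omit_map: "omit k (map f ys) = map f (omit k ys)"
  by (simp add: omit_def take_map drop_map)

lemma omit_append: "k < length ys \<Longrightarrow> omit k (ys @ a) = omit k ys @ a"
  by (simp add: omit_def)

lemma omit_Cons_0: "omit 0 (y # ys) = ys"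
  by (simp add: omit_def)

lemma omit_Cons_Suc: "omit (Suc k) (y # ys) = y # omit k ys"
  by (simp add: omit_def)

lemma mset_omit: "k < length ys \<Longrightarrow> mset (ys ! k # omit k ys) = mset ys"
  unfolding omit_def
  by (subst (3) id_take_nth_drop[of k ys]) simp_all

lemma length_omit: "k < length ys \<Longrightarrow> Suc (length (omit k ys)) = length ys"
  using arg_cong[OF mset_omit, of k ys size] by simp

lemma set_omit: "k < length ys \<Longrightarrow> insert (ys ! k) (set (omit k ys)) = set ys"
  using arg_cong[OF mset_omit, of k ys set_mset] by simp

lemma distinct_omit:
  "k < length ys \<Longrightarrow> distinct ys \<Longrightarrow> distinct (omit k ys) \<and> ys ! k \<notin> set (omit k ys)"
  using mset_eq_imp_distinct_iff[OF mset_omit, of k ys] by auto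

lemma compl_tuple:
  assumes "finite E" "set xs \<subseteq> E" "distinct xs"
  shows "distinct (compl_tuple E xs)" "set (compl_tuple E xs) = E - set xs"
    "length (compl_tuple E xs) = card E - length xs"
proof -
  show d: "distinct (compl_tuple E xs)" and s: "set (compl_tuple E xs) = E - set xs"
    using enum_of[OF assms(1)] by (auto simp: compl_tuple_def)
  show "length (compl_tuple E xs) = card E - length xs"
    using distinct_card[OF d] distinct_card[OF assms(3)] s assms
    by (simp add: card_Diff_subset)
qed

lemma mset_eq_of_distinct:
  "distinct xs \<Longrightarrow> distinct ys \<Longrightarrow> set xs = set ys \<Longrightarrow> mset xs = mset ys"
  by (simp add: set_eq_iff_mset_eq_distinct)

lemma circuit_vec_nth:
  assumes "distinct ys" "i < length ys"
  shows "circuit_vec NF \<phi> ys (ys ! i) = neg_one NF ^ i * \<phi> (omit i ys)"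
proof -
  have "(THE j. j < length ys \<and> ys ! j = ys ! i) = i"
    using assms by (intro the_equality) (auto simp: nth_eq_iff_index_eq)
  then show ?thesis using assms by (simp add: circuit_vec_def)
qed

lemma circuit_vec_outside: "e \<notin> set ys \<Longrightarrow> circuit_vec NF \<phi> ys e = 0"
  by (simp add: circuit_vec_def)

lemma circuit_vec_scale:
  "circuit_vec NF (\<lambda>xs. b * \<phi> xs) ys e = b * circuit_vec NF \<phi> ys e"
  by (simp add: circuit_vec_def Let_def mult.left_commute)

lemma dual_gp_scale: "dual_gp NF E r (\<lambda>xs. b * \<phi> xs) = (\<lambda>xs. b * dual_gp NF E r \<phi> xs)"
  by (auto simp: dual_gp_def fun_eq_iff mult.left_commute)

lemma sum_circuit_vec:
  fixes G :: "'e \<Rightarrow> 'f::{comm_monoid_mult, mult_zero}"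
  assumes "finite E" "distinct ys" "set ys \<subseteq> E"
  shows "(\<Sum>e\<in>E. gs_embed (circuit_vec NF \<phi> ys e * G e)) =
    (\<Sum>k<length ys. gs_embed (neg_one NF ^ k * \<phi> (omit k ys) * G (ys ! k)))"
proof -
  have "(\<Sum>e\<in>E. gs_embed (circuit_vec NF \<phi> ys e * G e)) =
      (\<Sum>e\<in>set ys. gs_embed (circuit_vec NF \<phi> ys e * G e))"
    using assms by (intro sum.mono_neutral_right) (auto simp: circuit_vec_outside gs_embed_def)
  also have "\<dots> = (\<Sum>k<length ys. gs_embed (circuit_vec NF \<phi> ys (ys ! k) * G (ys ! k)))"
    using sum.reindex_bij_betw[OF bij_betw_nth[OF assms(2) refl refl],
        of "\<lambda>e. gs_embed (circuit_vec NF \<phi> ys e * G e)"] by simp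
  finally show ?thesis using assms(2) by (simp add: circuit_vec_nth)
qed

section \<open>Vectors and covectors without duality\<close>

definition represents ::
    "'f::{comm_monoid_mult, mult_zero} multiset set \<Rightarrow> ('e, 'f) fmatroid \<Rightarrow> ('e list \<Rightarrow> 'f) \<Rightarrow> bool"
  where
  "represents NF M \<phi> \<longleftrightarrow>
     finite (ground M) \<and> gp_function NF (ground M) (rank M) \<phi> \<and> gp_fns M = gp_class \<phi>"

lemma is_fmatroid_iff: "is_fmatroid NF M \<longleftrightarrow> (\<exists>\<phi>. represents NF M \<phi>)"
  by (auto simp: is_fmatroid_def represents_def)

lemma gp_rank_le_card: "gp_function NF E r \<phi> \<Longrightarrow> finite E \<Longrightarrow> r \<le> card E"
proof -
  assume gp: "gp_function NF E r \<phi>" and "finite E"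
  then obtain xs where "\<phi> xs \<noteq> 0" by (auto simp: gp_function_def)
  from gp_nonzeroD[OF gp this] \<open>finite E\<close> show ?thesis
    by (metis card_mono distinct_card)
qed

context idyll
begin

text \<open>
  Let \<open>z\<close> be the complement of \<open>y\<close>. Removing \<open>y\<^sub>i\<close> from \<open>y\<close> moves it into the complement, so the
  dual function at this tuple is \<open>\<phi> (y\<^sub>i, z)\<close> up to sign. The sign of moving \<open>y\<^sub>i\<close> behind the later
  entries of \<open>y\<close> and the sign \<open>(-1)\<^sup>i\<close> in the circuit have a product independent of \<open>i\<close>.
\<close>

lemma dual_circuit_vec:
  assumes gp: "gp_function NF E r \<phi>" and "finite E"
    and ys: "ys \<in> tuples E (Suc (card E - r))" "distinct ys"
  obtains \<epsilon> where "\<epsilon> \<noteq> 0"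
    "\<And>e. e \<in> E \<Longrightarrow>
       circuit_vec NF (dual_gp NF E r \<phi>) ys e = \<epsilon> * \<phi> (e # compl_tuple E ys)"
proof -
  let ?zs = "compl_tuple E ys" and ?s = "arrangement_sign NF E" and ?n = "neg_one NF"
  let ?\<epsilon> = "?n ^ (card E - r) * ?s (ys @ ?zs)"
  have E: "set ys \<subseteq> E" and len: "length ys = Suc (card E - r)"
    using ys by (auto simp: tuples_def)
  note zs = compl_tuple[OF \<open>finite E\<close> E ys(2)]
  note alt = arrangement_sign_adj_alternating[OF \<open>finite E\<close>]
  have "?\<epsilon> \<noteq> 0"
    using arrangement_sign_nonzero[of "ys @ ?zs" E] zs E ys(2)
    by (auto simp: mult_eq_zero_iff neg_one_power_nonzero)
  moreover have "circuit_vec NF (dual_gp NF E r \<phi>) ys e = ?\<epsilon> * \<phi> (e # ?zs)"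
    if "e \<in> E" for e
  proof (cases "e \<in> set ys")
    case False
    then have "e \<in> set ?zs" using that zs by simp
    then have "\<phi> (e # ?zs) = 0" using gp_nonzeroD(3)[OF gp] by fastforce
    then show ?thesis using False by (simp add: circuit_vec_outside)
  next
    case True
    then obtain i where i: "i < length ys" and e: "e = ys ! i" by (auto simp: in_set_conv_nth)
    let ?y = "omit i ys" and ?w = "compl_tuple E (omit i ys)"
    have y: "distinct ?y" "e \<notin> set ?y" "insert e (set ?y) = set ys"
        "Suc (length ?y) = length ys"
      using distinct_omit[OF i ys(2)] set_omit[OF i] length_omit[OF i] e by auto
    have yE: "set ?y \<subseteq> E" using y(3) E by auto
    note w = compl_tuple[OF \<open>finite E\<close> yE y(1)]
    have "mset ?w = mset (e # ?zs)"
      using w zs y True that by (intro mset_eq_of_distinct) auto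
    from adj_alternating_rearrange[OF this]
    obtain m where m: "\<forall>(\<psi> :: 'a list \<Rightarrow> 'f) u v. adj_alternating NF \<psi> \<longrightarrow>
        \<psi> (u @ ?w @ v) = ?n ^ m * \<psi> (u @ (e # ?zs) @ v)" ..
    \<comment> \<open>The order in which \<open>?w\<close> lists the complement is irrelevant: rearranging it into
        \<open>(e, ?zs)\<close> produces the same sign in both factors.\<close>
    have "dual_gp NF E r \<phi> ?y = ?s (?y @ ?w) * \<phi> ?w"
      using y yE w len by (auto simp: dual_gp_def tuples_def arrangement_sign_def)
    also have "?s (?y @ ?w) = ?n ^ m * ?s (?y @ e # ?zs)"
      using m[rule_format, OF alt, of ?y "[]"] by simp
    also have "\<phi> ?w = ?n ^ m * \<phi> (e # ?zs)"
      using m[rule_format, OF gp_adj_alternating[OF gp], of "[]" "[]"] by simp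
    finally have dual: "dual_gp NF E r \<phi> ?y = ?s (?y @ e # ?zs) * \<phi> (e # ?zs)"
      by (simp only: neg_one_power_mult_cancel)
    \<comment> \<open>Moving \<open>e\<close> from position \<open>i\<close> to the end of \<open>ys\<close> passes \<open>card E - r - i\<close> entries.\<close>
    have "ys @ ?zs = take i ys @ e # drop (Suc i) ys @ ?zs"
      using id_take_nth_drop[OF i] e by (metis append.assoc append_Cons)
    then have "?s (ys @ ?zs) = ?s (take i ys @ e # drop (Suc i) ys @ ?zs)"
      by (rule arg_cong)
    also have "\<dots> = ?n ^ length (drop (Suc i) ys) * ?s (take i ys @ drop (Suc i) ys @ e # ?zs)"
      by (rule adj_alternating_move[OF alt])
    finally have "?s (ys @ ?zs) = ?n ^ (card E - r - i) * ?s (?y @ e # ?zs)"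
      using len by (simp add: omit_def)
    then have "?n ^ i * ?s (?y @ e # ?zs) = ?n ^ (i + (card E - r - i)) * ?s (ys @ ?zs)"
      by (simp add: power_add mult.assoc neg_one_power_cancel)
    moreover have "i + (card E - r - i) = card E - r" using i len by simp
    ultimately have "?n ^ i * ?s (?y @ e # ?zs) = ?\<epsilon>" by simp
    then show ?thesis
      using circuit_vec_nth[OF ys(2) i, of NF "dual_gp NF E r \<phi>"] dual e
      by (simp add: mult.assoc[symmetric])
  qed
  ultimately show thesis using that by blast
qed

text \<open>
  Up to scalars, the cocircuits are the functions \<open>e \<mapsto> \<phi> (e, z)\<close>. Tuples \<open>z\<close> for which this function
  is zero, in particular those with repeated entries, give no cocircuit, but then the condition is trivial.
\<close>

lemma vectors_iff:
  assumes "represents NF M \<phi>"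
  shows "X \<in> vectors NF M \<longleftrightarrow> X \<in> fspace (ground M) \<and>
    (\<forall>zs. set zs \<subseteq> ground M \<and> Suc (length zs) = rank M \<longrightarrow>
       (\<Sum>e\<in>ground M. gs_embed (X e * \<phi> (e # zs))) \<in> NF)"
    (is "_ \<longleftrightarrow> _ \<and> ?null")
proof -
  let ?E = "ground M" and ?r = "rank M"
  let ?d = "dual_gp NF ?E ?r \<phi>"
  have fin: "finite ?E" and gp: "gp_function NF ?E ?r \<phi>" and cls: "gp_fns M = gp_class \<phi>"
    using assms by (auto simp: represents_def)
  have le: "?r \<le> card ?E" by (rule gp_rank_le_card[OF gp fin])
  have "(\<forall>Y\<in>cocircuits NF M. orthogonal NF ?E X Y) \<longleftrightarrow> ?null"
  proof
    assume null: ?null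
    show "\<forall>Y\<in>cocircuits NF M. orthogonal NF ?E X Y"
    proof
      fix Y
      assume "Y \<in> cocircuits NF M"
      then obtain a b ys where
        Y: "Y = (\<lambda>e. a * circuit_vec NF (dual_gp NF ?E ?r (\<lambda>xs. b * \<phi> xs)) ys e)"
        and ys: "ys \<in> tuples ?E (Suc (card ?E - ?r))" "distinct ys"
        by (auto simp: cocircuits_def circuits_def dual_fmatroid_def cls gp_class_def)
      obtain \<epsilon> where \<epsilon>: "\<And>e. e \<in> ?E \<Longrightarrow>
          circuit_vec NF ?d ys e = \<epsilon> * \<phi> (e # compl_tuple ?E ys)"
        using dual_circuit_vec[OF gp fin ys] by metis
      have sub: "set ys \<subseteq> ?E" and len: "length ys = Suc (card ?E - ?r)"
        using ys by (auto simp: tuples_def)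
      note zs = compl_tuple[OF fin sub ys(2)]
      have "length ys \<le> card ?E"
        using distinct_card[OF ys(2)] card_mono[OF fin sub] by simp
      then have "Suc (length (compl_tuple ?E ys)) = ?r" using zs(3) len le by simp
      then have "(\<Sum>e\<in>?E. gs_embed (X e * \<phi> (e # compl_tuple ?E ys))) \<in> NF"
        using null zs(2) by simp
      then have "(\<Sum>e\<in>?E. gs_embed (a * b * \<epsilon> * (X e * \<phi> (e # compl_tuple ?E ys)))) \<in> NF"
        by (rule null_scale)
      also have "(\<Sum>e\<in>?E. gs_embed (a * b * \<epsilon> * (X e * \<phi> (e # compl_tuple ?E ys)))) =
          (\<Sum>e\<in>?E. gs_embed (X e * Y e))"
        by (intro sum.cong refl)
          (simp add: Y dual_gp_scale circuit_vec_scale \<epsilon> mult.assoc mult.left_commute)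
      finally show "orthogonal NF ?E X Y" by (simp add: orthogonal_def)
    qed
  next
    assume orth: "\<forall>Y\<in>cocircuits NF M. orthogonal NF ?E X Y"
    show ?null
    proof (intro allI impI, elim conjE)
      fix zs
      assume zs: "set zs \<subseteq> ?E" "Suc (length zs) = ?r"
      show "(\<Sum>e\<in>?E. gs_embed (X e * \<phi> (e # zs))) \<in> NF"
      proof (cases "\<exists>e\<in>?E. \<phi> (e # zs) \<noteq> 0")
        case False
        then show ?thesis by (simp add: null_zero)
      next
        case True
        then obtain e0 where e0: "e0 \<in> ?E" "\<phi> (e0 # zs) \<noteq> 0" by blast
        then have d: "distinct zs" using gp_nonzeroD(3)[OF gp] by fastforce
        let ?ys = "compl_tuple ?E zs"
        note ys = compl_tuple[OF fin zs(1) d]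
        have ys': "?ys \<in> tuples ?E (Suc (card ?E - ?r))"
          using ys zs(2) le by (auto simp: tuples_def)
        note ysE = ys(2)[THEN equalityD1, THEN subset_trans, OF Diff_subset]
        obtain \<epsilon> where \<epsilon>: "\<epsilon> \<noteq> 0" "\<And>e. e \<in> ?E \<Longrightarrow>
            circuit_vec NF ?d ?ys e = \<epsilon> * \<phi> (e # compl_tuple ?E ?ys)"
          using dual_circuit_vec[OF gp fin ys' ys(1)] by metis
        have ms: "mset (compl_tuple ?E ?ys) = mset zs"
          using compl_tuple[OF fin ysE ys(1)] ys(2) zs(1) d by (intro mset_eq_of_distinct) auto
        obtain m where m: "\<forall>u v. \<phi> (u @ compl_tuple ?E ?ys @ v) =
            neg_one NF ^ m * \<phi> (u @ zs @ v)"
          using gp_rearrange[OF gp ms] ..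
        let ?\<delta> = "\<epsilon> * neg_one NF ^ m"
        have \<delta>: "?\<delta> \<noteq> 0" using \<epsilon>(1) by (simp add: mult_eq_zero_iff neg_one_power_nonzero)
        \<comment> \<open>The complement of \<open>?ys\<close> is \<open>zs\<close> up to order, which costs only a sign.\<close>
        have cv: "circuit_vec NF ?d ?ys e = ?\<delta> * \<phi> (e # zs)" if "e \<in> ?E" for e
          using \<epsilon>(2)[OF that] m[rule_format, of "[e]" "[]"] by (simp add: mult.assoc)
        then have nz: "circuit_vec NF ?d ?ys e0 \<noteq> 0"
          using e0 \<delta> by (simp add: mult_eq_zero_iff)
        then obtain k where k: "k < length ?ys" "e0 = ?ys ! k"
          using circuit_vec_outside[of e0 ?ys] by (metis in_set_conv_nth)
        then have "?d (omit k ?ys) \<noteq> 0"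
          using nz circuit_vec_nth[OF ys(1) k(1), of NF ?d] by auto
        moreover have "k \<le> card ?E - ?r" using k(1) ys' by (simp add: tuples_def)
        moreover have "\<phi> \<in> gp_fns M"
          unfolding cls gp_class_def using one_neq_zero by (auto intro!: exI[of _ 1])
        ultimately have "circuit_vec NF ?d ?ys \<in> cocircuits NF M"
          using ys' ys(1) one_neq_zero
          unfolding cocircuits_def circuits_def dual_fmatroid_def
          by (intro CollectI exI[of _ 1] exI[of _ ?d] exI[of _ ?ys]) auto
        then have null: "(\<Sum>e\<in>?E. gs_embed (X e * circuit_vec NF ?d ?ys e)) \<in> NF"
          using orth by (auto simp: orthogonal_def)
        obtain \<gamma> where \<gamma>: "?\<delta> * \<gamma> = 1" using invertible[OF \<delta>] by blast
        from null have "(\<Sum>e\<in>?E. gs_embed (\<gamma> * (X e * circuit_vec NF ?d ?ys e))) \<in> NF"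
          by (rule null_scale)
        also have "(\<Sum>e\<in>?E. gs_embed (\<gamma> * (X e * circuit_vec NF ?d ?ys e))) =
            (\<Sum>e\<in>?E. gs_embed (X e * \<phi> (e # zs)))"
        proof (intro sum.cong refl arg_cong[where f = gs_embed])
          fix e assume "e \<in> ?E"
          then have "\<gamma> * (X e * circuit_vec NF ?d ?ys e) = (?\<delta> * \<gamma>) * (X e * \<phi> (e # zs))"
            by (simp only: cv mult.assoc mult.left_commute mult.commute)
          then show "\<gamma> * (X e * circuit_vec NF ?d ?ys e) = X e * \<phi> (e # zs)"
            by (simp only: \<gamma> mult_1_left)
        qed
        finally show ?thesis .
      qed
    qed
  qed
  then show ?thesis by (simp add: vectors_def)
qed

lemma covectorI:
  assumes rep: "represents NF M \<phi>" and "Y \<in> fspace (ground M)"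
    and null: "\<And>ys. ys \<in> tuples (ground M) (Suc (rank M)) \<Longrightarrow> distinct ys \<Longrightarrow>
      (\<Sum>k\<le>rank M. gs_embed (neg_one NF ^ k * \<phi> (omit k ys) * Y (ys ! k))) \<in> NF"
  shows "Y \<in> covectors NF M"
  unfolding covectors_def
proof (intro CollectI conjI ballI)
  show "Y \<in> fspace (ground M)" by fact
  fix X
  assume "X \<in> circuits NF M"
  then obtain a b ys where X: "X = (\<lambda>e. a * circuit_vec NF (\<lambda>xs. b * \<phi> xs) ys e)"
    and ys: "ys \<in> tuples (ground M) (Suc (rank M))" "distinct ys"
    using rep by (auto simp: circuits_def represents_def gp_class_def)
  have "(\<Sum>e\<in>ground M. gs_embed (circuit_vec NF \<phi> ys e * Y e)) \<in> NF"
    using null[OF ys] sum_circuit_vec[of "ground M" ys NF \<phi> Y] ys rep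
    by (simp add: tuples_def represents_def lessThan_Suc_atMost)
  then have "(\<Sum>e\<in>ground M. gs_embed (a * b * (circuit_vec NF \<phi> ys e * Y e))) \<in> NF"
    by (rule null_scale)
  then show "orthogonal NF (ground M) Y X"
    by (simp add: orthogonal_def X circuit_vec_scale mult.assoc mult.commute mult.left_commute)
qed

text \<open>
  Orthogonality of circuits and cocircuits is exactly the Grassmann-Pluecker relation.
\<close>

lemma circuit_vec_is_vector:
  assumes rep: "represents NF M \<phi>"
    and ys: "ys \<in> tuples (ground M) (Suc (rank M))" "distinct ys"
  shows "circuit_vec NF \<phi> ys \<in> vectors NF M"
  unfolding vectors_iff[OF rep]
proof (intro conjI allI impI, goal_cases)
  case 1
  then show ?case using ys circuit_vec_outside by (fastforce simp: fspace_def tuples_def)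
next
  case (2 zs)
  have "(\<Sum>k = 0..rank M. gs_embed (neg_one NF ^ k * \<phi> (omit k ys) * \<phi> ((ys ! k) # zs))) \<in> NF"
    using rep 2 ys(1) unfolding represents_def gp_function_def by blast
  then show ?case
    using sum_circuit_vec[of "ground M" ys NF \<phi> "\<lambda>e. \<phi> (e # zs)"] ys rep
    by (simp add: tuples_def represents_def lessThan_Suc_atMost atMost_atLeast0)
qed

end

section \<open>Pullbacks and perfection on arbitrary ground sets\<close>

text \<open>
  Contraction of \<open>a\<close>, relabelling by \<open>f\<close> and rescaling by \<open>c\<close> at the same time. A zero of \<open>c\<close>
  becomes a loop, so restriction to a subset and extension by \<open>0\<close> are covered as well.
\<close>

definition pullback ::
    "('s \<Rightarrow> 'f::{comm_monoid_mult, mult_zero}) \<Rightarrow> ('s \<Rightarrow> 't) \<Rightarrow> 't list \<Rightarrow> ('t list \<Rightarrow> 'f) \<Rightarrow> 's list \<Rightarrow> 'f"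
  where
  "pullback c f a \<phi> xs = prod_list (map c xs) * \<phi> (map f xs @ a)"

lemma subset_imageE_list:
  assumes "set ys \<subseteq> f ` A"
  obtains xs where "set xs \<subseteq> A" "ys = map f xs"
proof -
  have "ys \<in> lists (f ` A)" using assms by (simp add: lists_eq_set)
  then have "ys \<in> map f ` lists A" by (simp only: lists_image)
  then show thesis using that by (auto simp: lists_eq_set)
qed

lemma permute_list_append:
  assumes "p permutes {..<length xs}"
  shows "permute_list p (xs @ ys) = permute_list p xs @ ys"
proof (rule nth_equalityI)
  fix i
  assume "i < length (permute_list p (xs @ ys))"
  then have i: "i < length xs + length ys" by simp
  then have "permute_list p (xs @ ys) ! i = (xs @ ys) ! p i"
    by (simp add: permute_list_def)
  moreover have "p i < length xs \<longleftrightarrow> i < length xs"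
    using permutes_in_image[OF assms, of i] by simp
  moreover have "\<not> i < length xs \<Longrightarrow> p i = i"
    using permutes_not_in[OF assms, of i] by simp
  ultimately show "permute_list p (xs @ ys) ! i = (permute_list p xs @ ys) ! i"
    by (cases "i < length xs") (simp_all add: nth_append permute_list_def)
qed simp

lemma prod_list_omit:
  fixes c :: "'s \<Rightarrow> 'f::comm_monoid_mult"
  assumes "k < length ys"
  shows "prod_list (map c ys) = c (ys ! k) * prod_list (map c (omit k ys))"
proof -
  have "prod_list (map c ys) = prod_mset (mset (map c ys))" by (rule prod_mset_prod_list[symmetric])
  also have "mset (map c ys) = mset (map c (ys ! k # omit k ys))"
    by (simp only: mset_map mset_omit[OF assms])
  also have "prod_mset \<dots> = prod_list (map c (ys ! k # omit k ys))" by (rule prod_mset_prod_list)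
  finally show ?thesis by simp
qed

lemma sum_prefix_eq:
  fixes h :: "nat \<Rightarrow> 'a::comm_monoid_add"
  assumes "k \<le> r" and "\<And>i. k < i \<Longrightarrow> i \<le> r \<Longrightarrow> h i = 0"
  shows "(\<Sum>i\<le>k. h i) = (\<Sum>i\<le>r. h i)"
  using assms by (intro sum.mono_neutral_left) auto

lemma gp_relation:
  assumes "gp_function NF E r \<phi>" "set xs \<subseteq> E" "Suc (length xs) = r" "ys \<in> tuples E (Suc r)"
  shows "(\<Sum>k\<le>r. gs_embed (neg_one NF ^ k * \<phi> (omit k ys) * \<phi> (ys ! k # xs))) \<in> NF"
  using assms unfolding gp_function_def atMost_atLeast0 by blast

context idyll
begin

text \<open>
  For entries with nonzero scalars, the relation for \<open>x\<close> and \<open>y\<close> is a multiple of the relation of \<open>\<phi>\<close>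
  for \<open>(f x, a)\<close> and \<open>(f y, a)\<close>: the additional terms of the latter, at the positions of \<open>a\<close>, contain
  an entry of \<open>a\<close> twice and vanish.
\<close>

lemma pullback_gp_function:
  assumes gp: "gp_function NF T r \<phi>"
    and c: "\<And>s. c s \<noteq> 0 \<Longrightarrow> s \<in> S \<and> f s \<in> T"
    and nonzero: "\<exists>xs. pullback c f a \<phi> xs \<noteq> 0"
    and k: "k + length a = r"
  shows "gp_function NF S k (pullback c f a \<phi>)"
proof -
  let ?p = "pullback c f a \<phi>"
  have supp: "set xs \<subseteq> S \<and> set (map f xs) \<subseteq> T \<and> (\<forall>x\<in>set xs. c x \<noteq> 0)"
    if "prod_list (map c xs) \<noteq> 0" for xs
    using that c by (fastforce simp: prod_list_eq_zero_iff)
  have pD: "xs \<in> tuples S k \<and> distinct xs" if "?p xs \<noteq> 0" for xs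
  proof -
    have "prod_list (map c xs) \<noteq> 0" and nz: "\<phi> (map f xs @ a) \<noteq> 0"
      using that by (auto simp: pullback_def)
    then show ?thesis
      using supp[of xs] gp_nonzeroD[OF gp nz] k by (auto simp: tuples_def distinct_map)
  qed
  have aT: "set a \<subseteq> T"
  proof -
    obtain xs where "?p xs \<noteq> 0" using nonzero by blast
    then have "\<phi> (map f xs @ a) \<noteq> 0" by (auto simp: pullback_def)
    from gp_nonzeroD(1)[OF gp this] show ?thesis by simp
  qed
  have perm: "?p (permute_list q xs) = sign_in NF q * ?p xs"
    if xs: "xs \<in> tuples S k" and q: "q permutes {..<k}" for xs q
  proof -
    have len: "length xs = k" using xs by (simp add: tuples_def)
    have "mset (map c (permute_list q xs)) = mset (map c xs)"
      using q len by (simp add: mset_permute_list)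
    then have "prod_list (map c (permute_list q xs)) = prod_list (map c xs)"
      using prod_mset_prod_list by metis
    moreover have "\<phi> (map f (permute_list q xs) @ a) = sign_in NF q * \<phi> (map f xs @ a)"
    proof -
      have eq: "map f (permute_list q xs) @ a = permute_list q (map f xs @ a)"
        using q len by (simp add: permute_list_append permute_list_map)
      have qr: "q permutes {..<r}"
        using q k by (auto intro: permutes_subset)
      show ?thesis
      proof (cases "map f xs @ a \<in> tuples T r")
        case True
        then show ?thesis unfolding eq using gp qr unfolding gp_function_def by blast
      next
        case False
        then have "permute_list q (map f xs @ a) \<notin> tuples T r"
          using qr len k by (simp add: tuples_def set_permute_list)
        with False show ?thesis unfolding eq using gp by (simp add: gp_function_def)
      qed
    qed
    ultimately show ?thesis by (simp add: pullback_def mult.left_commute)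
  qed
  have rel: "(\<Sum>i = 0..k. gs_embed (neg_one NF ^ i * ?p (omit i ys) * ?p (ys ! i # xs))) \<in> NF"
    if xs: "set xs \<subseteq> S" "Suc (length xs) = k" and ys: "ys \<in> tuples S (Suc k)" for xs ys
  proof -
    let ?W = "map f ys @ a" and ?Z = "map f xs @ a"
    let ?K = "prod_list (map c ys) * prod_list (map c xs)"
    let ?h = "\<lambda>i. gs_embed (neg_one NF ^ i * \<phi> (omit i ?W) * \<phi> (?W ! i # ?Z))"
    have len: "length ys = Suc k" using ys by (simp add: tuples_def)
    have "gs_embed (neg_one NF ^ i * ?p (omit i ys) * ?p (ys ! i # xs)) =
        gs_embed (?K * (neg_one NF ^ i * \<phi> (omit i ?W) * \<phi> (?W ! i # ?Z)))" if "i \<le> k" for i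
    proof -
      have i: "i < length ys" using that len by simp
      then have W: "omit i ?W = map f (omit i ys) @ a" "?W ! i = f (ys ! i)"
        by (simp_all add: omit_append omit_map nth_append)
      show ?thesis
        unfolding W prod_list_omit[OF i, of c] pullback_def
        by (simp add: ac_simps)
    qed
    then have "(\<Sum>i = 0..k. gs_embed (neg_one NF ^ i * ?p (omit i ys) * ?p (ys ! i # xs))) =
        (\<Sum>i\<le>k. gs_embed (?K * (neg_one NF ^ i * \<phi> (omit i ?W) * \<phi> (?W ! i # ?Z))))"
      by (simp add: atMost_atLeast0)
    also have "\<dots> \<in> NF"
    proof (cases "?K = 0")
      case True
      then show ?thesis by (simp add: null_zero)
    next
      case False
      then have "prod_list (map c ys) \<noteq> 0" "prod_list (map c xs) \<noteq> 0"
        by (simp_all add: mult_eq_zero_iff)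
      then have W: "?W \<in> tuples T (Suc r)" and Z: "set ?Z \<subseteq> T" "Suc (length ?Z) = r"
        using supp[of ys] supp[of xs] aT len k xs(2) by (auto simp: tuples_def)
      \<comment> \<open>At these positions \<open>?W ! i\<close> is an entry of \<open>a\<close>, which also occurs in \<open>?Z\<close>.\<close>
      have "?h i = 0" if "k < i" "i \<le> r" for i
      proof -
        have "?W ! i \<in> set a"
          using that len k by (simp add: nth_append)
        then have "\<phi> (?W ! i # ?Z) = 0"
          using gp_nonzeroD(3)[OF gp, of "?W ! i # ?Z"] by auto
        then show ?thesis by simp
      qed
      then have "(\<Sum>i\<le>k. ?h i) = (\<Sum>i\<le>r. ?h i)"
        using k by (intro sum_prefix_eq) auto
      then have "(\<Sum>i\<le>k. ?h i) \<in> NF"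
        using gp_relation[OF gp Z W] by simp
      then show ?thesis by (rule null_scale)
    qed
    finally show ?thesis .
  qed
  show ?thesis
    unfolding gp_function_def
    using pD nonzero perm rel by blast
qed

text \<open>
  Perfection speaks of matroids on sets of natural numbers. It is transported to an arbitrary ground set
  by pulling the Grassmann-Pluecker function back along an enumeration. The condition on \<open>Y\<close> is that of
  a covector.
\<close>

lemma perfect_orthogonal:
  fixes M :: "('e, 'f) fmatroid"
  assumes perfect: "perfect_idyll NF" and rep: "represents NF M \<phi>"
    and X: "X \<in> vectors NF M"
    and Y: "\<And>ys. ys \<in> tuples (ground M) (Suc (rank M)) \<Longrightarrow>
      (\<Sum>k\<le>rank M. gs_embed (neg_one NF ^ k * \<phi> (omit k ys) * Y (ys ! k))) \<in> NF"
  shows "(\<Sum>e\<in>ground M. gs_embed (X e * Y e)) \<in> NF"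
proof -
  let ?E = "ground M" and ?r = "rank M"
  have fin: "finite ?E" and gp: "gp_function NF ?E ?r \<phi>"
    using rep by (auto simp: represents_def)
  obtain g where g: "bij_betw g {..<card ?E} ?E"
    using ex_bij_betw_nat_finite[OF fin] by (auto simp: lessThan_atLeast0)
  let ?I = "{..<card ?E}"
  define c :: "nat \<Rightarrow> 'f" where "c i = (if i \<in> ?I then 1 else 0)" for i
  let ?p = "pullback c g [] \<phi>"
  have p: "?p xs = \<phi> (map g xs)" if "set xs \<subseteq> ?I" for xs
  proof -
    have "prod_list (map c xs) = 1" using that by (induction xs) (auto simp: c_def)
    then show ?thesis by (simp add: pullback_def)
  qed
  have gI: "g i \<in> ?E" if "i \<in> ?I" for i using g that by (auto simp: bij_betw_def)
  have gmap: "set (map g xs) \<subseteq> ?E" if "set xs \<subseteq> ?I" for xs using that gI by auto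
  define M' :: "(nat, 'f) fmatroid" where
    "M' = \<lparr>ground = ?I, rank = ?r, gp_fns = gp_class ?p\<rparr>"
  have "gp_function NF ?I ?r ?p"
  proof (rule pullback_gp_function[OF gp])
    show "i \<in> ?I \<and> g i \<in> ?E" if "c i \<noteq> 0" for i using that gI by (auto simp: c_def split: if_splits)
    obtain es where es: "\<phi> es \<noteq> 0" using gp by (auto simp: gp_function_def)
    have "set es \<subseteq> g ` ?I" using gp_nonzeroD(1)[OF gp es] g by (simp add: bij_betw_def)
    then obtain xs where "set xs \<subseteq> ?I" "es = map g xs"
      by (rule subset_imageE_list)
    with es p show "\<exists>xs. ?p xs \<noteq> 0" by metis
  qed simp
  then have rep': "represents NF M' ?p" by (simp add: represents_def M'_def)
  then have M': "is_fmatroid NF M'" by (auto simp: is_fmatroid_iff)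
  define X' where "X' i = (if i \<in> ?I then X (g i) else 0)" for i
  define Y' where "Y' i = (if i \<in> ?I then Y (g i) else 0)" for i
  have reindex: "(\<Sum>i\<in>?I. h (g i)) = (\<Sum>e\<in>?E. h e)" for h :: "'e \<Rightarrow> 'f multiset"
    by (rule sum.reindex_bij_betw[OF g])
  have "X' \<in> vectors NF M'"
    unfolding vectors_iff[OF rep']
  proof (intro conjI allI impI)
    show "X' \<in> fspace (ground M')" by (simp add: fspace_def M'_def X'_def)
    fix zs
    assume zs: "set zs \<subseteq> ground M' \<and> Suc (length zs) = rank M'"
    then have "set zs \<subseteq> ?I" by (simp add: M'_def)
    then have "(\<Sum>i\<in>?I. gs_embed (X' i * ?p (i # zs))) =
        (\<Sum>i\<in>?I. gs_embed (X (g i) * \<phi> (g i # map g zs)))"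
      by (intro sum.cong refl) (simp add: X'_def p)
    also have "\<dots> = (\<Sum>e\<in>?E. gs_embed (X e * \<phi> (e # map g zs)))"
      by (rule reindex[of "\<lambda>e. gs_embed (X e * \<phi> (e # map g zs))"])
    also have "\<dots> \<in> NF"
    proof -
      have "set (map g zs) \<subseteq> ?E \<and> Suc (length (map g zs)) = ?r"
        using zs gmap[OF \<open>set zs \<subseteq> ?I\<close>] by (simp add: M'_def)
      then show ?thesis using X unfolding vectors_iff[OF rep] by blast
    qed
    finally show "(\<Sum>i\<in>ground M'. gs_embed (X' i * ?p (i # zs))) \<in> NF" by (simp add: M'_def)
  qed
  moreover have "Y' \<in> covectors NF M'"
  proof (rule covectorI[OF rep'])
    show "Y' \<in> fspace (ground M')" by (simp add: fspace_def M'_def Y'_def)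
    fix ys
    assume ys: "ys \<in> tuples (ground M') (Suc (rank M'))"
    then have len: "length ys = Suc ?r" and sub: "set ys \<subseteq> ?I" by (auto simp: M'_def tuples_def)
    have "(\<Sum>k\<le>?r. gs_embed (neg_one NF ^ k * ?p (omit k ys) * Y' (ys ! k))) =
        (\<Sum>k\<le>?r. gs_embed (neg_one NF ^ k * \<phi> (omit k (map g ys)) * Y (map g ys ! k)))"
    proof (intro sum.cong refl)
      fix k
      assume "k \<in> {..?r}"
      then have k: "k < length ys" using len by simp
      have "set (omit k ys) \<subseteq> ?I" using set_omit[OF k] sub by blast
      moreover have "ys ! k \<in> ?I" using nth_mem[OF k] sub by blast
      ultimately show "gs_embed (neg_one NF ^ k * ?p (omit k ys) * Y' (ys ! k)) =
          gs_embed (neg_one NF ^ k * \<phi> (omit k (map g ys)) * Y (map g ys ! k))"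
        using k by (simp add: p omit_map Y'_def)
    qed
    also have "\<dots> \<in> NF"
      using gmap[OF sub] len by (intro Y) (simp add: tuples_def)
    finally show "(\<Sum>k\<le>rank M'. gs_embed (neg_one NF ^ k * ?p (omit k ys) * Y' (ys ! k))) \<in> NF"
      by (simp add: M'_def)
  qed
  ultimately have "orthogonal NF (ground M') X' Y'"
    using perfect M' unfolding perfect_idyll_def by blast
  then have "(\<Sum>i\<in>?I. gs_embed (X (g i) * Y (g i))) \<in> NF"
    by (simp add: orthogonal_def M'_def X'_def Y'_def)
  then show ?thesis using reindex[of "\<lambda>e. gs_embed (X e * Y e)"] by simp
qed

end

section \<open>The preimage of the vectors under a submonomial matrix\<close>

context idyll
begin

lemma the_gs_embed: "(THE a. gs_embed a = gs_embed b) = (b::'f)"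
  by (rule the_equality) (simp_all add: gs_embed_inj)

text \<open>
  The matrix acts as a partial map \<open>f\<close> with weights \<open>c\<close>: at most one nonzero entry per column makes \<open>f\<close>
  well defined, at most one per row makes it injective. The formula is the adjunction between pushing \<open>V\<close>
  forward and pulling \<open>G\<close> back along this partial map.
\<close>

lemma submonomial_as_partial_map:
  fixes S :: "'s set" and T :: "'t set" and \<Phi> :: "'t \<Rightarrow> 's \<Rightarrow> 'f"
  assumes "finite S" "finite T" and sub: "submonomial T S \<Phi>"
  shows "\<exists>(c :: 's \<Rightarrow> 'f) (f :: 's \<Rightarrow> 't). (\<forall>s. c s \<noteq> 0 \<longrightarrow> s \<in> S \<and> f s \<in> T) \<and>
    (\<forall>V G. (\<Sum>t\<in>T. gs_embed (mat_apply T S \<Phi> V t * G t)) =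
       (\<Sum>s\<in>S. gs_embed (c s * V s * G (f s))))"
proof -
  define P where "P s t \<longleftrightarrow> s \<in> S \<and> t \<in> T \<and> \<Phi> t s \<noteq> 0" for s t
  define f where "f s = (SOME t. P s t)" for s
  define c where "c s = (if \<exists>t. P s t then \<Phi> (f s) s else 0)" for s
  have col: "t = t'" if "P s t" "P s t'" for s t t'
    using sub that unfolding submonomial_def P_def by blast
  have row: "s = s'" if "P s t" "P s' t" for s s' t
    using sub that unfolding submonomial_def P_def by blast
  have fP: "f s = t" if "P s t" for s t
    using col[OF someI[of "P s", OF that] that] by (simp add: f_def)
  have cP: "c s = \<Phi> t s" if "P s t" for s t using that fP[OF that] by (auto simp: c_def)
  have c0: "P s (f s)" if nz: "c s \<noteq> 0" for s
  proof -
    obtain t where "P s t" using nz by (auto simp: c_def split: if_splits)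
    then show ?thesis using fP[OF \<open>P s t\<close>] by simp
  qed
  have image: "mat_apply T S \<Phi> V (f s) = c s * V s" if "c s \<noteq> 0" for V s
  proof -
    have P: "P s (f s)" by (rule c0[OF that])
    then have "\<Phi> (f s) s' = 0" if "s' \<in> S - {s}" for s'
      using row[OF P, of s'] that P by (auto simp: P_def)
    then have "(\<Sum>j\<in>S. gs_embed (\<Phi> (f s) j * V j)) = (\<Sum>j\<in>{s}. gs_embed (\<Phi> (f s) j * V j))"
      using P \<open>finite S\<close> by (intro sum.mono_neutral_right) (auto simp: P_def)
    then show ?thesis using P cP[OF P] by (simp add: mat_apply_def the_gs_embed P_def)
  qed
  have outside: "mat_apply T S \<Phi> V t = 0" if "t \<notin> f ` {s. c s \<noteq> 0}" for V t
  proof (cases "t \<in> T")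
    case True
    have "\<Phi> t j = 0" if "j \<in> S" for j
    proof (rule ccontr)
      assume "\<Phi> t j \<noteq> 0"
      then have P: "P j t" using True that by (simp add: P_def)
      then have "t = f j" "c j \<noteq> 0" using fP[OF P] cP[OF P] \<open>\<Phi> t j \<noteq> 0\<close> by auto
      then show False using \<open>t \<notin> f ` {s. c s \<noteq> 0}\<close> by auto
    qed
    then have "(\<Sum>j\<in>S. gs_embed (\<Phi> t j * V j)) = gs_embed 0" by simp
    then show ?thesis using True by (simp add: mat_apply_def the_gs_embed del: gs_embed_zero)
  qed (simp add: mat_apply_def)
  have cT: "s \<in> S \<and> f s \<in> T" if "c s \<noteq> 0" for s
    using c0[OF that] by (simp add: P_def)
  show ?thesis
  proof (intro exI[of _ c] exI[of _ f] conjI allI impI)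
    show "s \<in> S" "f s \<in> T" if "c s \<noteq> 0" for s
      using cT[OF that] by simp_all
    show "(\<Sum>t\<in>T. gs_embed (mat_apply T S \<Phi> V t * G t)) =
        (\<Sum>s\<in>S. gs_embed (c s * V s * G (f s)))" for V G
    proof -
      have inj: "inj_on f {s. c s \<noteq> 0}"
      proof (rule inj_onI)
        fix s s'
        assume "s \<in> {s. c s \<noteq> 0}" "s' \<in> {s. c s \<noteq> 0}" "f s = f s'"
        then have "P s (f s)" "P s' (f s)" using c0[of s] c0[of s'] by simp_all
        then show "s = s'" by (rule row)
      qed
      have "(\<Sum>t\<in>T. gs_embed (mat_apply T S \<Phi> V t * G t)) =
          (\<Sum>t\<in>f ` {s. c s \<noteq> 0}. gs_embed (mat_apply T S \<Phi> V t * G t))"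
        using cT outside \<open>finite T\<close> by (intro sum.mono_neutral_right) auto
      also have "\<dots> = (\<Sum>s\<in>{s. c s \<noteq> 0}. gs_embed (mat_apply T S \<Phi> V (f s) * G (f s)))"
        by (simp add: sum.reindex[OF inj])
      also have "\<dots> = (\<Sum>s\<in>{s. c s \<noteq> 0}. gs_embed (c s * V s * G (f s)))"
        by (intro sum.cong refl) (simp add: image)
      also have "\<dots> = (\<Sum>s\<in>S. gs_embed (c s * V s * G (f s)))"
        using cT \<open>finite S\<close> by (intro sum.mono_neutral_left) auto
      finally show ?thesis .
    qed
  qed
qed

text \<open>
  Let \<open>f\<close> and \<open>c\<close> describe the matrix, and let \<open>I\<close> be the image under \<open>f\<close> of the support of \<open>c\<close>. The rank
  of \<open>N\<close> is the maximal number \<open>k\<close> of elements of \<open>I\<close> in a basis of \<open>M\<close>. By maximality a tuple with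
  \<open>k + 1\<close> entries in \<open>I\<close> is not a basis, which makes pullbacks of cocircuits of \<open>M\<close> covectors of \<open>N\<close>.
\<close>

lemma exists_preimage_matroid:
  fixes S :: "'s set" and M :: "('t, 'f) fmatroid" and \<Phi> :: "'t \<Rightarrow> 's \<Rightarrow> 'f"
  assumes perfect: "perfect_idyll NF" and "finite S"
    and rep: "represents NF M \<phi>" and sub: "submonomial (ground M) S \<Phi>"
  obtains N :: "('s, 'f) fmatroid" where "is_fmatroid NF N" "ground N = S"
    "vectors NF N = {V \<in> fspace S. mat_apply (ground M) S \<Phi> V \<in> vectors NF M}"
proof -
  let ?T = "ground M" and ?r = "rank M"
  have fin: "finite ?T" and gp: "gp_function NF ?T ?r \<phi>"
    using rep by (auto simp: represents_def)
  obtain c :: "'s \<Rightarrow> 'f" and f :: "'s \<Rightarrow> 't" where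
    cf: "(\<forall>s. c s \<noteq> 0 \<longrightarrow> s \<in> S \<and> f s \<in> ?T) \<and>
      (\<forall>V G. (\<Sum>t\<in>?T. gs_embed (mat_apply ?T S \<Phi> V t * G t)) =
         (\<Sum>s\<in>S. gs_embed (c s * V s * G (f s))))"
    using submonomial_as_partial_map[OF \<open>finite S\<close> fin sub] by (elim exE)
  note c = cf[THEN conjunct1, rule_format] and apply_sum = cf[THEN conjunct2, rule_format]
  let ?img = "f ` {s. c s \<noteq> 0}"
  define Q where "Q k \<longleftrightarrow> (\<exists>xs a. set xs \<subseteq> ?img \<and> length xs = k \<and> \<phi> (xs @ a) \<noteq> 0)" for k
  have bound: "k \<le> ?r" if "Q k" for k
    using that gp_nonzeroD(2)[OF gp] by (fastforce simp: Q_def)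
  have "Q 0" using gp by (auto simp: Q_def gp_function_def)
  then obtain k where k: "Q k" and max: "\<And>k'. Q k' \<Longrightarrow> k' \<le> k"
    using Nat.ex_has_greatest_nat[of Q 0 ?r] bound by blast
  then obtain ts a where ts: "set ts \<subseteq> ?img" "length ts = k" "\<phi> (ts @ a) \<noteq> 0"
    by (auto simp: Q_def)
  have len: "k + length a = ?r" using gp_nonzeroD(2)[OF gp ts(3)] ts(2) by simp
  have aT: "set a \<subseteq> ?T" using gp_nonzeroD(1)[OF gp ts(3)] by simp
  have spanning: "\<phi> (ws @ b) = 0" if "set ws \<subseteq> ?img" "length ws = Suc k" for ws b
    using that max[of "Suc k"] by (auto simp: Q_def)
  let ?p = "pullback c f a \<phi>"
  obtain ss where "set ss \<subseteq> {s. c s \<noteq> 0}" "ts = map f ss"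
    using ts(1) by (rule subset_imageE_list)
  then have "?p ss \<noteq> 0"
    using ts(3) by (auto simp: pullback_def mult_eq_zero_iff prod_list_eq_zero_iff)
  then have gpN: "gp_function NF S k ?p"
    using c len by (intro pullback_gp_function[OF gp]) blast+
  define N where "N = \<lparr>ground = S, rank = k, gp_fns = gp_class ?p\<rparr>"
  have repN: "represents NF N ?p"
    using gpN \<open>finite S\<close> by (simp add: represents_def N_def)
  have vec: "V \<in> vectors NF N \<longleftrightarrow> mat_apply ?T S \<Phi> V \<in> vectors NF M" if V: "V \<in> fspace S" for V
  proof
    assume W: "mat_apply ?T S \<Phi> V \<in> vectors NF M"
    show "V \<in> vectors NF N"
      unfolding vectors_iff[OF repN]
    proof (intro conjI allI impI)
      show "V \<in> fspace (ground N)" using V by (simp add: N_def)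
      fix zs
      assume zs: "set zs \<subseteq> ground N \<and> Suc (length zs) = rank N"
      let ?Z = "map f zs @ a" and ?K = "prod_list (map c zs)"
      have "(\<Sum>s\<in>S. gs_embed (?K * (c s * V s * \<phi> (f s # ?Z)))) \<in> NF"
      proof (cases "?K = 0")
        case True
        then show ?thesis by (simp add: null_zero)
      next
        case False
        then have "set ?Z \<subseteq> ?T" using c aT by (fastforce simp: prod_list_eq_zero_iff)
        moreover have "Suc (length ?Z) = ?r" using zs len by (simp add: N_def)
        ultimately have "(\<Sum>t\<in>?T. gs_embed (mat_apply ?T S \<Phi> V t * \<phi> (t # ?Z))) \<in> NF"
          using W unfolding vectors_iff[OF rep] by blast
        then have "(\<Sum>s\<in>S. gs_embed (c s * V s * \<phi> (f s # ?Z))) \<in> NF"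
          using apply_sum[of V "\<lambda>t. \<phi> (t # ?Z)"] by simp
        then show ?thesis by (rule null_scale)
      qed
      also have "(\<Sum>s\<in>S. gs_embed (?K * (c s * V s * \<phi> (f s # ?Z)))) =
          (\<Sum>s\<in>S. gs_embed (V s * ?p (s # zs)))"
        by (intro sum.cong refl) (simp add: pullback_def ac_simps)
      finally show "(\<Sum>e\<in>ground N. gs_embed (V e * ?p (e # zs))) \<in> NF"
        by (simp add: N_def)
    qed
  next
    assume VN: "V \<in> vectors NF N"
    show "mat_apply ?T S \<Phi> V \<in> vectors NF M"
      unfolding vectors_iff[OF rep]
    proof (intro conjI allI impI)
      show "mat_apply ?T S \<Phi> V \<in> fspace ?T" by (simp add: fspace_def mat_apply_def)
      fix zs
      assume zs: "set zs \<subseteq> ?T \<and> Suc (length zs) = ?r"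
      \<comment> \<open>The pullback of the cocircuit of \<open>M\<close> that belongs to \<open>zs\<close>.\<close>
      define Y where "Y s = c s * \<phi> (f s # zs)" for s
      have "(\<Sum>e\<in>ground N. gs_embed (V e * Y e)) \<in> NF"
      proof (rule perfect_orthogonal[OF perfect repN VN])
        fix ys
        assume "ys \<in> tuples (ground N) (Suc (rank N))"
        then have ys: "length ys = Suc k" by (simp add: N_def tuples_def)
        let ?W = "map f ys @ a" and ?K = "prod_list (map c ys)"
        let ?h = "\<lambda>i. gs_embed (neg_one NF ^ i * \<phi> (omit i ?W) * \<phi> (?W ! i # zs))"
        have "gs_embed (neg_one NF ^ i * ?p (omit i ys) * Y (ys ! i)) =
            gs_embed (?K * (neg_one NF ^ i * \<phi> (omit i ?W) * \<phi> (?W ! i # zs)))" if "i \<le> k" for i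
        proof -
          have i: "i < length ys" using that ys by simp
          then have W: "omit i ?W = map f (omit i ys) @ a" "?W ! i = f (ys ! i)"
            by (simp_all add: omit_append omit_map nth_append)
          show ?thesis
            unfolding W prod_list_omit[OF i, of c] pullback_def Y_def by (simp add: ac_simps)
        qed
        then have "(\<Sum>i\<le>k. gs_embed (neg_one NF ^ i * ?p (omit i ys) * Y (ys ! i))) =
            (\<Sum>i\<le>k. gs_embed (?K * (neg_one NF ^ i * \<phi> (omit i ?W) * \<phi> (?W ! i # zs))))"
          by simp
        also have "\<dots> \<in> NF"
        proof (cases "?K = 0")
          case True
          then show ?thesis by (simp add: null_zero)
        next
          case False
          then have nz: "set ys \<subseteq> {s. c s \<noteq> 0}" by (auto simp: prod_list_eq_zero_iff)
          then have W: "?W \<in> tuples ?T (Suc ?r)"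
            using c aT ys len by (fastforce simp: tuples_def)
          \<comment> \<open>Here \<open>omit i ?W\<close> still starts with the \<open>k + 1\<close> entries \<open>map f ys\<close>.\<close>
          have "?h i = 0" if "k < i" "i \<le> ?r" for i
          proof -
            have "omit i ?W = map f ys @ omit (i - Suc k) a"
              using that ys by (simp add: omit_def Suc_diff_Suc)
            moreover have "set (map f ys) \<subseteq> ?img" using nz by auto
            ultimately have "\<phi> (omit i ?W) = 0" using spanning[of "map f ys"] ys by simp
            then show ?thesis by simp
          qed
          then have "(\<Sum>i\<le>k. ?h i) = (\<Sum>i\<le>?r. ?h i)"
            using len by (intro sum_prefix_eq) auto
          then have "(\<Sum>i\<le>k. ?h i) \<in> NF"
            using gp_relation[OF gp _ _ W, of zs] zs by simp
          then show ?thesis by (rule null_scale)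
        qed
        finally show "(\<Sum>i\<le>rank N. gs_embed (neg_one NF ^ i * ?p (omit i ys) * Y (ys ! i))) \<in> NF"
          by (simp add: N_def)
      qed
      also have "(\<Sum>e\<in>ground N. gs_embed (V e * Y e)) =
          (\<Sum>s\<in>S. gs_embed (c s * V s * \<phi> (f s # zs)))"
        unfolding N_def by (auto simp: Y_def ac_simps intro!: sum.cong arg_cong[of _ _ gs_embed])
      also have "\<dots> = (\<Sum>t\<in>?T. gs_embed (mat_apply ?T S \<Phi> V t * \<phi> (t # zs)))"
        by (rule apply_sum[symmetric, of V "\<lambda>t. \<phi> (t # zs)"])
      finally show "(\<Sum>t\<in>?T. gs_embed (mat_apply ?T S \<Phi> V t * \<phi> (t # zs))) \<in> NF" .
    qed
  qed
  show thesis
  proof (rule that)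
    show "is_fmatroid NF N" using repN is_fmatroid_iff by blast
    show "ground N = S" by (simp add: N_def)
    have "V \<in> fspace S" if "V \<in> vectors NF N" for V
      using that by (simp add: vectors_def N_def)
    then show "vectors NF N = {V \<in> fspace S. mat_apply ?T S \<Phi> V \<in> vectors NF M}"
      using vec by blast
  qed
qed

end

section \<open>A matroid is determined by its vectors\<close>

context idyll
begin

text \<open>
  If \<open>e\<close> belongs to a basis, the cocircuit given by the other elements of the basis vanishes on them, so
  its product with a vector supported on the basis has only the term at \<open>e\<close>; a single nonzero element
  is not in the nullset.
\<close>

lemma basis_supports_no_vector:
  assumes rep: "represents NF M \<phi>" and X: "X \<in> vectors NF M"
    and nz: "\<phi> xs \<noteq> 0" and supp: "\<And>e. X e \<noteq> 0 \<Longrightarrow> e \<in> set xs"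
  shows "X e = 0"
proof (rule ccontr)
  assume e: "X e \<noteq> 0"
  have fin: "finite (ground M)" and gp: "gp_function NF (ground M) (rank M) \<phi>"
    using rep by (auto simp: represents_def)
  obtain i where i: "i < length xs" "xs ! i = e"
    using supp[OF e] by (auto simp: in_set_conv_nth)
  let ?zs = "omit i xs"
  note xs = gp_nonzeroD[OF gp nz]
  have zs: "insert e (set ?zs) = set xs" "Suc (length ?zs) = rank M"
    using set_omit[OF i(1)] length_omit[OF i(1)] i(2) xs by auto
  have "mset xs = mset (e # ?zs)" using mset_omit[OF i(1)] i(2) by simp
  from gp_rearrange[OF gp this] obtain m
    where m: "\<forall>u v. \<phi> (u @ xs @ v) = neg_one NF ^ m * \<phi> (u @ (e # ?zs) @ v)" ..
  have nz': "\<phi> (e # ?zs) \<noteq> 0" using m[rule_format, of "[]" "[]"] nz by auto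
  have "(\<Sum>e'\<in>ground M. gs_embed (X e' * \<phi> (e' # ?zs))) \<in> NF"
    using X zs xs(1) unfolding vectors_iff[OF rep] by blast
  also have "(\<Sum>e'\<in>ground M. gs_embed (X e' * \<phi> (e' # ?zs))) =
      (\<Sum>e'\<in>{e}. gs_embed (X e' * \<phi> (e' # ?zs)))"
  proof (intro sum.mono_neutral_right fin ballI)
    show "{e} \<subseteq> ground M" using zs(1) xs(1) by auto
    fix e'
    assume e': "e' \<in> ground M - {e}"
    show "gs_embed (X e' * \<phi> (e' # ?zs)) = {#}"
    proof (cases "X e' = 0")
      case False
      then have "e' \<in> set ?zs" using supp[OF False] zs(1) e' by auto
      then have "\<phi> (e' # ?zs) = 0" using gp_nonzeroD(3)[OF gp, of "e' # ?zs"] by auto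
      then show ?thesis by simp
    qed simp
  qed
  finally have "X e * \<phi> (e # ?zs) = 0" by (simp add: null_single_iff)
  then show False using e nz' by (simp add: mult_eq_zero_iff)
qed

text \<open>
  As long as the independent set \<open>I\<close> has an element \<open>e\<close> outside of the basis, the fundamental circuit of
  \<open>e\<close> is a nonzero vector. It is not supported on \<open>I\<close>, so some basis element outside of \<open>I\<close> can be
  exchanged for \<open>e\<close>, and the basis gets closer to \<open>I\<close>. The invariant \<open>P\<close> serves to follow the ratio of two
  Grassmann-Pluecker functions along the exchanges.
\<close>

lemma exchange_towards:
  assumes rep: "represents NF M \<phi>" and "I \<subseteq> ground M"
    and indep: "\<And>X e. X \<in> vectors NF M \<Longrightarrow> (\<And>e. X e \<noteq> 0 \<Longrightarrow> e \<in> I) \<Longrightarrow> X e = 0"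
    and start: "\<phi> xs \<noteq> 0" "P xs"
    and step: "\<And>ys e i. \<phi> ys \<noteq> 0 \<Longrightarrow> P ys \<Longrightarrow> i < length ys \<Longrightarrow> e \<in> ground M - set ys \<Longrightarrow>
      \<phi> (e # omit i ys) \<noteq> 0 \<Longrightarrow> P (e # omit i ys)"
  shows "\<exists>ys. \<phi> ys \<noteq> 0 \<and> P ys \<and> I \<subseteq> set ys"
  using start
proof (induction "card (I - set xs)" arbitrary: xs rule: less_induct)
  case less
  have gp: "gp_function NF (ground M) (rank M) \<phi>" and fin: "finite I"
    using rep finite_subset[OF \<open>I \<subseteq> ground M\<close>] by (simp_all add: represents_def)
  note xs = gp_nonzeroD[OF gp less.prems(1)]
  show ?case
  proof (cases "I \<subseteq> set xs")
    case True
    then show ?thesis using less.prems by blast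
  next
    case False
    then obtain e where e: "e \<in> I" "e \<notin> set xs" by blast
    let ?y = "e # xs"
    have y: "?y \<in> tuples (ground M) (Suc (rank M))" "distinct ?y"
      using xs e \<open>I \<subseteq> ground M\<close> by (auto simp: tuples_def)
    let ?C = "circuit_vec NF \<phi> ?y"
    have C: "?C \<in> vectors NF M" by (rule circuit_vec_is_vector[OF rep y])
    have "?C e = \<phi> xs"
      using circuit_vec_nth[OF y(2), of 0 NF \<phi>] by (simp add: omit_Cons_0)
    then have "?C e \<noteq> 0" using less.prems(1) by simp
    then obtain b where b: "?C b \<noteq> 0" "b \<notin> I" using indep[OF C] by blast
    then have "b \<in> set ?y" using circuit_vec_outside[of b ?y] by blast
    then have "b \<in> set xs" using b(2) e(1) by auto
    then obtain i where i: "i < length xs" "b = xs ! i" by (auto simp: in_set_conv_nth)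
    have Cb: "?C b = neg_one NF ^ Suc i * \<phi> (e # omit i xs)"
      using circuit_vec_nth[OF y(2), of "Suc i" NF \<phi>] i
      by (simp add: omit_Cons_Suc del: power_Suc)
    have nz: "\<phi> (e # omit i xs) \<noteq> 0"
    proof
      assume "\<phi> (e # omit i xs) = 0"
      then have "?C b = 0" by (simp only: Cb mult_zero_right)
      then show False using b(1) by contradiction
    qed
    have "set xs = insert b (set (omit i xs))" using set_omit[OF i(1)] by (simp only: i(2))
    then have "I - set (e # omit i xs) \<subseteq> I - set xs - {e}" using b(2) by auto
    then have "I - set (e # omit i xs) \<subset> I - set xs" using e by blast
    then have "card (I - set (e # omit i xs)) < card (I - set xs)"
      using fin by (intro psubset_card_mono) auto
    moreover have "P (e # omit i xs)"
      using step[OF less.prems i(1) _ nz] e \<open>I \<subseteq> ground M\<close> by blast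
    ultimately show ?thesis using less.hyps[OF _ nz] by blast
  qed
qed

text \<open>
  A basis of the first matroid is independent with respect to the common vectors, so a basis of the second
  one can be moved over it.
\<close>

lemma basis_extends:
  assumes rep1: "represents NF M1 \<phi>1" and rep2: "represents NF M2 \<phi>2"
    and ground: "ground M1 = ground M2" and vec: "vectors NF M1 = vectors NF M2"
    and nz: "\<phi>1 xs \<noteq> 0"
  obtains ys where "\<phi>2 ys \<noteq> 0" "set xs \<subseteq> set ys"
proof -
  obtain x0 where x0: "\<phi>2 x0 \<noteq> 0"
    using rep2 by (auto simp: represents_def gp_function_def)
  have gp: "gp_function NF (ground M2) (rank M1) \<phi>1"
    using rep1 ground by (simp add: represents_def)
  have "\<exists>ys. \<phi>2 ys \<noteq> 0 \<and> True \<and> set xs \<subseteq> set ys"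
  proof (rule exchange_towards[OF rep2])
    show "set xs \<subseteq> ground M2" by (rule gp_nonzeroD(1)[OF gp nz])
    show "X e = 0" if "X \<in> vectors NF M2" "\<And>e. X e \<noteq> 0 \<Longrightarrow> e \<in> set xs" for X e
      using basis_supports_no_vector[OF rep1 _ nz] that vec by blast
  qed (use x0 in simp_all)
  then show thesis using that by blast
qed

lemma same_vectors_rank_le:
  assumes "represents NF M1 \<phi>1" "represents NF M2 \<phi>2"
    and "ground M1 = ground M2" "vectors NF M1 = vectors NF M2"
  shows "rank M1 \<le> rank M2"
proof -
  have gp: "gp_function NF (ground M1) (rank M1) \<phi>1" "gp_function NF (ground M2) (rank M2) \<phi>2"
    using assms by (auto simp: represents_def)
  obtain xs where xs: "\<phi>1 xs \<noteq> 0" using gp(1) by (auto simp: gp_function_def)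
  obtain ys where ys: "\<phi>2 ys \<noteq> 0" "set xs \<subseteq> set ys" by (rule basis_extends[OF assms xs])
  show ?thesis
    using gp_nonzeroD[OF gp(1) xs] gp_nonzeroD[OF gp(2) ys(1)] card_mono[OF _ ys(2)]
    by (simp add: distinct_card)
qed

lemma same_vectors_nonzero:
  assumes rep: "represents NF M1 \<phi>1" "represents NF M2 \<phi>2"
    and ground: "ground M1 = ground M2" and vec: "vectors NF M1 = vectors NF M2"
    and nz: "\<phi>1 xs \<noteq> 0"
  shows "\<phi>2 xs \<noteq> 0"
proof -
  have gp: "gp_function NF (ground M1) (rank M1) \<phi>1" "gp_function NF (ground M2) (rank M2) \<phi>2"
    using rep by (auto simp: represents_def)
  have rank: "rank M1 = rank M2"
    using same_vectors_rank_le[OF rep ground vec]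
      same_vectors_rank_le[OF rep(2,1) ground[symmetric] vec[symmetric]] by simp
  obtain ys where ys: "\<phi>2 ys \<noteq> 0" "set xs \<subseteq> set ys"
    by (rule basis_extends[OF rep ground vec nz])
  note x = gp_nonzeroD[OF gp(1) nz] and y = gp_nonzeroD[OF gp(2) ys(1)]
  have "set xs = set ys"
    using x y rank ys(2) by (intro card_subset_eq) (simp_all add: distinct_card)
  then have "mset ys = mset xs" using x y by (intro mset_eq_of_distinct) simp_all
  from gp_rearrange[OF gp(2) this] obtain m
    where m: "\<forall>u v. \<phi>2 (u @ ys @ v) = neg_one NF ^ m * \<phi>2 (u @ xs @ v)" ..
  show ?thesis using m[rule_format, of "[]" "[]"] ys(1) by auto
qed

text \<open>
  The circuit of the first matroid on \<open>(e, b, z)\<close> is a vector of the second one, hence orthogonal to its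
  cocircuit given by \<open>z\<close>. That cocircuit vanishes on \<open>z\<close>, so only the terms at \<open>e\<close> and \<open>b\<close> are left.
\<close>

lemma same_vectors_adjacent_ratio:
  assumes rep: "represents NF M1 \<phi>1" "represents NF M2 \<phi>2"
    and ground: "ground M1 = ground M2" and vec: "vectors NF M1 = vectors NF M2"
    and rank: "rank M1 = rank M2"
    and zs: "set (e # b # zs) \<subseteq> ground M1" "distinct (e # b # zs)" "Suc (length zs) = rank M1"
  shows "\<phi>1 (b # zs) * \<phi>2 (e # zs) = \<phi>1 (e # zs) * \<phi>2 (b # zs)"
proof -
  let ?y = "e # b # zs" and ?r = "rank M1"
  have fin: "finite (ground M1)" and gp2: "gp_function NF (ground M2) (rank M2) \<phi>2"
    using rep by (auto simp: represents_def)
  let ?h = "\<lambda>k. gs_embed (neg_one NF ^ k * \<phi>1 (omit k ?y) * \<phi>2 (?y ! k # zs))"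
  have "?y \<in> tuples (ground M1) (Suc ?r)" using zs by (simp add: tuples_def)
  then have "circuit_vec NF \<phi>1 ?y \<in> vectors NF M2"
    using circuit_vec_is_vector[OF rep(1) _ zs(2)] vec by simp
  then have "(\<Sum>x\<in>ground M1. gs_embed (circuit_vec NF \<phi>1 ?y x * \<phi>2 (x # zs))) \<in> NF"
    using zs rank ground unfolding vectors_iff[OF rep(2)] by auto
  also have "(\<Sum>x\<in>ground M1. gs_embed (circuit_vec NF \<phi>1 ?y x * \<phi>2 (x # zs))) =
      (\<Sum>k<length ?y. ?h k)"
    by (rule sum_circuit_vec[OF fin zs(2,1)])
  also have "\<dots> = (\<Sum>k\<in>{0, 1}. ?h k)"
  proof (intro sum.mono_neutral_right ballI)
    fix k
    assume k: "k \<in> {..<length ?y} - {0, 1}"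
    then have "?y ! k \<in> set zs" by (auto simp: nth_Cons' intro!: nth_mem)
    then have "\<phi>2 (?y ! k # zs) = 0" using gp_nonzeroD(3)[OF gp2, of "?y ! k # zs"] by auto
    then show "?h k = {#}" by simp
  qed auto
  finally have "gs_embed (\<phi>1 (b # zs) * \<phi>2 (e # zs)) +
      gs_embed (neg_one NF * (\<phi>1 (e # zs) * \<phi>2 (b # zs))) \<in> NF"
    by (simp add: omit_def mult.assoc)
  then show ?thesis by (rule null_difference)
qed

text \<open>
  The ratio of the two functions is kept by rearrangements and by exchanges, and exchanges lead from any
  basis to any other one.
\<close>

lemma same_vectors_ratio:
  assumes rep: "represents NF M1 \<phi>1" "represents NF M2 \<phi>2"
    and ground: "ground M1 = ground M2" and vec: "vectors NF M1 = vectors NF M2"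
    and rank: "rank M1 = rank M2"
    and xs: "\<phi>1 xs \<noteq> 0" and zs: "\<phi>1 zs \<noteq> 0"
  shows "\<phi>1 xs * \<phi>2 zs = \<phi>2 xs * \<phi>1 zs"
proof -
  have gp: "gp_function NF (ground M1) (rank M1) \<phi>1" "gp_function NF (ground M2) (rank M2) \<phi>2"
    using rep by (auto simp: represents_def)
  let ?P = "\<lambda>ys. \<phi>1 xs * \<phi>2 ys = \<phi>2 xs * \<phi>1 ys"
  have transfer: "?P ys'" if "?P ys" and ms: "mset ys' = mset ys" for ys ys'
  proof -
    from adj_alternating_rearrange[OF ms, where NF = NF] obtain m where
      m: "\<forall>(\<psi> :: 'a list \<Rightarrow> 'f) u v. adj_alternating NF \<psi> \<longrightarrow>
          \<psi> (u @ ys' @ v) = neg_one NF ^ m * \<psi> (u @ ys @ v)" ..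
    have "\<phi>1 ys' = neg_one NF ^ m * \<phi>1 ys" "\<phi>2 ys' = neg_one NF ^ m * \<phi>2 ys"
      using m[rule_format, OF gp_adj_alternating[OF gp(1)], of "[]" "[]"]
        m[rule_format, OF gp_adj_alternating[OF gp(2)], of "[]" "[]"] by simp_all
    then have "\<phi>1 xs * \<phi>2 ys' = neg_one NF ^ m * (\<phi>1 xs * \<phi>2 ys)"
      "\<phi>2 xs * \<phi>1 ys' = neg_one NF ^ m * (\<phi>2 xs * \<phi>1 ys)"
      by (simp_all only: mult.left_commute)
    then show ?thesis by (simp only: \<open>?P ys\<close>)
  qed
  have "\<exists>ys. \<phi>1 ys \<noteq> 0 \<and> ?P ys \<and> set zs \<subseteq> set ys"
  proof (rule exchange_towards[OF rep(1)])
    show "set zs \<subseteq> ground M1" by (rule gp_nonzeroD(1)[OF gp(1) zs])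
    show "X e = 0" if "X \<in> vectors NF M1" "\<And>e. X e \<noteq> 0 \<Longrightarrow> e \<in> set zs" for X e
      using basis_supports_no_vector[OF rep(1) _ zs] that by blast
    show "\<phi>1 xs \<noteq> 0" by (rule xs)
    show "?P xs" by (rule mult.commute)
    fix ys e i
    assume ys: "\<phi>1 ys \<noteq> 0" "?P ys" and i: "i < length ys" and e: "e \<in> ground M1 - set ys"
    let ?x = "omit i ys" and ?b = "ys ! i"
    note y = gp_nonzeroD[OF gp(1) ys(1)]
    have b: "?P (?b # ?x)" by (rule transfer[OF ys(2) mset_omit[OF i]])
    have "mset ys = mset (?b # ?x)" by (rule mset_omit[OF i, symmetric])
    from gp_rearrange[OF gp(1) this] obtain m
      where m: "\<forall>u v. \<phi>1 (u @ ys @ v) = neg_one NF ^ m * \<phi>1 (u @ (?b # ?x) @ v)" ..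
    have nz: "\<phi>1 (?b # ?x) \<noteq> 0" using m[rule_format, of "[]" "[]"] ys(1) by auto
    have adj: "\<phi>1 (?b # ?x) * \<phi>2 (e # ?x) = \<phi>1 (e # ?x) * \<phi>2 (?b # ?x)"
    proof (rule same_vectors_adjacent_ratio[OF rep ground vec rank])
      show "set (e # ?b # ?x) \<subseteq> ground M1" using e y set_omit[OF i] by auto
      show "distinct (e # ?b # ?x)" using e y distinct_omit[OF i] set_omit[OF i] by auto
      show "Suc (length ?x) = rank M1" using length_omit[OF i] y by simp
    qed
    have "\<phi>1 (?b # ?x) * (\<phi>1 xs * \<phi>2 (e # ?x)) = \<phi>1 xs * (\<phi>1 (?b # ?x) * \<phi>2 (e # ?x))"
      by (rule mult.left_commute)
    also have "\<dots> = \<phi>1 xs * (\<phi>1 (e # ?x) * \<phi>2 (?b # ?x))" by (simp only: adj)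
    also have "\<dots> = \<phi>1 (e # ?x) * (\<phi>1 xs * \<phi>2 (?b # ?x))" by (rule mult.left_commute)
    also have "\<dots> = \<phi>1 (e # ?x) * (\<phi>2 xs * \<phi>1 (?b # ?x))" by (simp only: b)
    also have "\<dots> = \<phi>1 (?b # ?x) * (\<phi>2 xs * \<phi>1 (e # ?x))" by (simp only: ac_simps)
    finally show "?P (e # ?x)" by (rule mult_left_cancel_nonzero[OF nz])
  qed
  then obtain ys where ys: "\<phi>1 ys \<noteq> 0" "?P ys" "set zs \<subseteq> set ys" by blast
  note y = gp_nonzeroD[OF gp(1) ys(1)] and z = gp_nonzeroD[OF gp(1) zs]
  have "set zs = set ys"
    using y z ys(3) by (intro card_subset_eq) (simp_all add: distinct_card)
  then have "mset zs = mset ys" using y z by (intro mset_eq_of_distinct)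
  then show ?thesis by (rule transfer[OF ys(2)])
qed

lemma gp_class_scale:
  assumes "a \<noteq> (0::'f)"
  shows "gp_class (\<lambda>xs. a * \<phi> xs) = gp_class \<phi>"
proof
  show "gp_class (\<lambda>xs. a * \<phi> xs) \<subseteq> gp_class \<phi>"
  proof
    fix \<psi>
    assume "\<psi> \<in> gp_class (\<lambda>xs. a * \<phi> xs)"
    then obtain b where b: "b \<noteq> 0" "\<psi> = (\<lambda>xs. b * (a * \<phi> xs))" by (auto simp: gp_class_def)
    then have "\<psi> = (\<lambda>xs. (b * a) * \<phi> xs)" by (simp add: mult.assoc)
    moreover have "b * a \<noteq> 0" using b assms by (simp add: mult_eq_zero_iff)
    ultimately show "\<psi> \<in> gp_class \<phi>" unfolding gp_class_def by blast
  qed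
  show "gp_class \<phi> \<subseteq> gp_class (\<lambda>xs. a * \<phi> xs)"
  proof
    fix \<psi>
    assume "\<psi> \<in> gp_class \<phi>"
    then obtain b where b: "b \<noteq> 0" "\<psi> = (\<lambda>xs. b * \<phi> xs)" by (auto simp: gp_class_def)
    obtain d where d: "a * d = 1" using invertible[OF assms] by blast
    then have "d * a = 1" by (simp add: mult.commute)
    then have "\<psi> = (\<lambda>xs. (b * d) * (a * \<phi> xs))"
      by (simp add: b(2) mult.assoc) (simp add: mult.assoc[symmetric])
    moreover have "b * d \<noteq> 0" using b d one_neq_zero by (auto simp: mult_eq_zero_iff)
    ultimately show "\<psi> \<in> gp_class (\<lambda>xs. a * \<phi> xs)" unfolding gp_class_def by blast
  qed
qed

lemma matroid_determined_by_vectors: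
  fixes M1 M2 :: "('e, 'f) fmatroid"
  assumes "is_fmatroid NF M1" "is_fmatroid NF M2"
    and ground: "ground M1 = ground M2" and vec: "vectors NF M1 = vectors NF M2"
  shows "M1 = M2"
proof -
  obtain \<phi>1 \<phi>2 where rep: "represents NF M1 \<phi>1" "represents NF M2 \<phi>2"
    using assms(1,2) by (auto simp: is_fmatroid_iff)
  have rank: "rank M1 = rank M2"
    using same_vectors_rank_le[OF rep ground vec]
      same_vectors_rank_le[OF rep(2,1) ground[symmetric] vec[symmetric]] by simp
  obtain x0 where x0: "\<phi>1 x0 \<noteq> 0" using rep(1) by (auto simp: represents_def gp_function_def)
  obtain d where d: "d * \<phi>1 x0 = 1"
    using invertible[OF x0] by (auto simp: mult.commute)
  have nz2: "\<phi>2 x0 \<noteq> 0" by (rule same_vectors_nonzero[OF rep ground vec x0])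
  let ?a = "d * \<phi>2 x0"
  have "d \<noteq> 0" using d one_neq_zero by auto
  then have a: "?a \<noteq> 0" using nz2 by (simp add: mult_eq_zero_iff)
  have "\<phi>2 zs = ?a * \<phi>1 zs" for zs
  proof (cases "\<phi>1 zs = 0")
    case True
    then have "\<phi>2 zs = 0"
      using same_vectors_nonzero[OF rep(2,1) ground[symmetric] vec[symmetric]] by blast
    then show ?thesis using True by simp
  next
    case False
    have "\<phi>2 zs = d * (\<phi>1 x0 * \<phi>2 zs)"
      using d by (simp add: mult.assoc[symmetric])
    also have "\<dots> = d * (\<phi>2 x0 * \<phi>1 zs)"
      by (simp only: same_vectors_ratio[OF rep ground vec rank x0 False])
    finally show ?thesis by (simp only: mult.assoc)
  qed
  then have "\<phi>2 = (\<lambda>zs. ?a * \<phi>1 zs)" by blast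
  then have "gp_fns M1 = gp_fns M2"
    using rep gp_class_scale[OF a, of \<phi>1] by (simp add: represents_def)
  then show ?thesis using ground rank by (intro fmatroid.equality) simp_all
qed

end

theorem propositionD:
  fixes NF :: "'f::{comm_monoid_mult, mult_zero} multiset set"
    and S :: "'s set" and T :: "'t set"
    and M :: "('t, 'f) fmatroid"
    and \<Phi> :: "'t \<Rightarrow> 's \<Rightarrow> 'f"
  assumes "perfect_idyll NF"
    and "finite S" and "finite T"
    and "is_fmatroid NF M" and "ground M = T"
    and "submonomial T S \<Phi>"
  shows "\<exists>!N :: ('s, 'f) fmatroid. is_fmatroid NF N \<and> ground N = S \<and>
           vectors NF N = {V \<in> fspace S. mat_apply T S \<Phi> V \<in> vectors NF M}"
proof -
  interpret idyll NF using assms(1) by (simp add: perfect_idyll_def)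
  obtain \<phi> where rep: "represents NF M \<phi>" using assms(4) is_fmatroid_iff by blast
  have sub: "submonomial (ground M) S \<Phi>" using assms(5,6) by simp
  obtain N :: "('s, 'f) fmatroid" where N: "is_fmatroid NF N" "ground N = S"
    "vectors NF N = {V \<in> fspace S. mat_apply (ground M) S \<Phi> V \<in> vectors NF M}"
    by (rule exists_preimage_matroid[OF assms(1,2) rep sub])
  show ?thesis
  proof (rule ex1I)
    show "is_fmatroid NF N \<and> ground N = S \<and>
        vectors NF N = {V \<in> fspace S. mat_apply T S \<Phi> V \<in> vectors NF M}"
      using N assms(5) by simp
  next
    fix N' :: "('s, 'f) fmatroid"
    assume "is_fmatroid NF N' \<and> ground N' = S \<and>
        vectors NF N' = {V \<in> fspace S. mat_apply T S \<Phi> V \<in> vectors NF M}"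
    then show "N' = N" using N assms(5) by (intro matroid_determined_by_vectors) simp_all
  qed
qed

end
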